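(* Fix an integer $d\ge2$. Let $\mathcal A_d=\mathbb Z[t]/(t^2-d^2t)$ and $\kappa=t-d^2\in\mathcal A_d$. As an $\mathcal A_d$-module, $\mathcal R_d=\mathcal A_d/(\kappa)$ has the two-periodic free resolution $$\cdots\xrightarrow{\,t\,}\mathcal A_d\xrightarrow{\,\kappa\,}\mathcal A_d\xrightarrow{\,t\,}\mathcal A_d\xrightarrow{\,\kappa\,}\mathcal A_d\longrightarrow\mathcal R_d\longrightarrow0.$$ For every $j\ge0$, $$\operatorname{Tor}_{2j+1}^{\mathcal A_d}(\mathcal R_d,\mathcal R_d)\cong\mathbb Z/d^2\mathbb Z,\qquad\operatorname{Tor}_{2j+2}^{\mathcal A_d}(\mathcal R_d,\mathcal R_d)=0,$$ $$\operatorname{Ext}^{2j+1}_{\mathcal A_d}(\mathcal R_d,\mathcal R_d)=0,\qquad\operatorname{Ext}^{2j+2}_{\mathcal A_d}(\mathcal R_d,\mathcal R_d)\cong\mathbb Z/d^2\mathbb Z.$$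
   Context: An arrow labelled $t$ or $\kappa$ is multiplication by that element. As a ring $\mathcal R_d\cong\mathbb Z$ via $t\mapsto d^2$. In the paper these rings arise as the operator ring and regular operator ring of the ternary $\mathbb Z$-ring $T_d=d\mathbb Z$ with $x\,n\,y\,m\,z=nmxyz$, but the statement concerns only the displayed rings. *)

theory Defs
  imports "HOL-Algebra.Algebra"
begin

section \<open>Modules over a commutative ring\<close>

definition regular_module :: "('a, 'r) ring_scheme \<Rightarrow> ('a, 'a) module" where
  "regular_module R = \<lparr>carrier = carrier R, monoid.mult = monoid.mult R, one = one R,
     ring.zero = ring.zero R, ring.add = ring.add R, smult = monoid.mult R\<rparr>"

definition quotient_module :: "('a, 'r) ring_scheme \<Rightarrow> 'a set \<Rightarrow> ('a, 'a set) module" where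
  "quotient_module R I = \<lparr>carrier = carrier (R Quot I), monoid.mult = monoid.mult (R Quot I),
     one = one (R Quot I), ring.zero = ring.zero (R Quot I), ring.add = ring.add (R Quot I),
     smult = (\<lambda>a C. (I +>\<^bsub>R\<^esub> a) \<otimes>\<^bsub>R Quot I\<^esub> C)\<rparr>"

definition linear_maps ::
  "('a, 'r) ring_scheme \<Rightarrow> ('a, 'b) module \<Rightarrow> ('a, 'c) module \<Rightarrow> ('b \<Rightarrow> 'c) set" where
  "linear_maps R M N = {f \<in> carrier M \<rightarrow> carrier N.
     (\<forall>x\<in>carrier M. \<forall>y\<in>carrier M. f (x \<oplus>\<^bsub>M\<^esub> y) = f x \<oplus>\<^bsub>N\<^esub> f y) \<and>
     (\<forall>a\<in>carrier R. \<forall>x\<in>carrier M. f (a \<odot>\<^bsub>M\<^esub> x) = a \<odot>\<^bsub>N\<^esub> f x)}"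

definition is_basis :: "('a, 'r) ring_scheme \<Rightarrow> ('a, 'b) module \<Rightarrow> 'b set \<Rightarrow> bool" where
  "is_basis R M B \<longleftrightarrow> B \<subseteq> carrier M \<and>
     (\<forall>x\<in>carrier M. \<exists>!c. c \<in> UNIV \<rightarrow> carrier R \<and>
        finite {b. c b \<noteq> \<zero>\<^bsub>R\<^esub>} \<and> {b. c b \<noteq> \<zero>\<^bsub>R\<^esub>} \<subseteq> B \<and>
        x = (\<Oplus>\<^bsub>M\<^esub>b\<in>{b. c b \<noteq> \<zero>\<^bsub>R\<^esub>}. c b \<odot>\<^bsub>M\<^esub> b))"

definition free_module :: "('a, 'r) ring_scheme \<Rightarrow> ('a, 'b) module \<Rightarrow> bool" where
  "free_module R M \<longleftrightarrow> module R M \<and> (\<exists>B. is_basis R M B)"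

text \<open>
  A module is projective if it is a direct summand (a linear retract) of a free module. Restricting
  the free module to the element type \<^typ>\<open>'b \<Rightarrow> 'a\<close> loses nothing: a projective module is a
  retract of the free module on its own underlying set, whose elements are the finitely supported
  functions from that set to the ring.
\<close>
definition projective_module :: "('a, 'r) ring_scheme \<Rightarrow> ('a, 'b) module \<Rightarrow> bool" where
  "projective_module R M \<longleftrightarrow> module R M \<and>
     (\<exists>(F :: ('a, 'b \<Rightarrow> 'a) module) i p. free_module R F \<and>
        i \<in> linear_maps R M F \<and> p \<in> linear_maps R F M \<and> (\<forall>x\<in>carrier M. p (i x) = x))"


section \<open>Resolutions\<close>

text \<open>
  The sequence \<open>\<dots> \<rightarrow> P 2 \<rightarrow> P 1 \<rightarrow> P 0 \<rightarrow> M \<rightarrow> 0\<close>, with \<open>\<delta> n : P (n + 1) \<rightarrow> P n\<close> and \<open>\<epsilon> : P 0 \<rightarrow> M\<close>,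
  consists of modules and linear maps and is exact.
\<close>
definition resolution ::
  "('a, 'r) ring_scheme \<Rightarrow> (nat \<Rightarrow> ('a, 'p) module) \<Rightarrow> (nat \<Rightarrow> 'p \<Rightarrow> 'p) \<Rightarrow>
   ('p \<Rightarrow> 'm) \<Rightarrow> ('a, 'm) module \<Rightarrow> bool" where
  "resolution R P \<delta> \<epsilon> M \<longleftrightarrow>
     module R M \<and> (\<forall>n. module R (P n)) \<and>
     (\<forall>n. \<delta> n \<in> linear_maps R (P (Suc n)) (P n)) \<and> \<epsilon> \<in> linear_maps R (P 0) M \<and>
     \<epsilon> ` carrier (P 0) = carrier M \<and>
     \<delta> 0 ` carrier (P 1) = a_kernel (P 0) M \<epsilon> \<and>
     (\<forall>n. \<delta> (Suc n) ` carrier (P (Suc (Suc n))) = a_kernel (P (Suc n)) (P n) (\<delta> n))"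

definition free_resolution ::
  "('a, 'r) ring_scheme \<Rightarrow> (nat \<Rightarrow> ('a, 'p) module) \<Rightarrow> (nat \<Rightarrow> 'p \<Rightarrow> 'p) \<Rightarrow>
   ('p \<Rightarrow> 'm) \<Rightarrow> ('a, 'm) module \<Rightarrow> bool" where
  "free_resolution R P \<delta> \<epsilon> M \<longleftrightarrow> resolution R P \<delta> \<epsilon> M \<and> (\<forall>n. free_module R (P n))"

definition projective_resolution ::
  "('a, 'r) ring_scheme \<Rightarrow> (nat \<Rightarrow> ('a, 'p) module) \<Rightarrow> (nat \<Rightarrow> 'p \<Rightarrow> 'p) \<Rightarrow>
   ('p \<Rightarrow> 'm) \<Rightarrow> ('a, 'm) module \<Rightarrow> bool" where
  "projective_resolution R P \<delta> \<epsilon> M \<longleftrightarrow>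
     resolution R P \<delta> \<epsilon> M \<and> (\<forall>n. projective_module R (P n))"


section \<open>Tensor products and groups of linear maps\<close>

text \<open>
  Both are formed as abelian groups, written multiplicatively as is customary for the library's
  \<^type>\<open>monoid\<close> records. The tensor product is the free abelian group on pairs modulo the
  subgroup generated by the bilinearity and balancing relations.
\<close>
definition tensor_relations ::
  "('a, 'r) ring_scheme \<Rightarrow> ('a, 'b) module \<Rightarrow> ('a, 'c) module \<Rightarrow> ('b \<times> 'c \<Rightarrow>\<^sub>0 int) set" where
  "tensor_relations R M N =
     generate (free_Abelian_group (carrier M \<times> carrier N))
      ({frag_of (x \<oplus>\<^bsub>M\<^esub> x', y) - frag_of (x, y) - frag_of (x', y) | x x' y.
          x \<in> carrier M \<and> x' \<in> carrier M \<and> y \<in> carrier N} \<union>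
       {frag_of (x, y \<oplus>\<^bsub>N\<^esub> y') - frag_of (x, y) - frag_of (x, y') | x y y'.
          x \<in> carrier M \<and> y \<in> carrier N \<and> y' \<in> carrier N} \<union>
       {frag_of (a \<odot>\<^bsub>M\<^esub> x, y) - frag_of (x, a \<odot>\<^bsub>N\<^esub> y) | a x y.
          a \<in> carrier R \<and> x \<in> carrier M \<and> y \<in> carrier N})"

definition tensor_group ::
  "('a, 'r) ring_scheme \<Rightarrow> ('a, 'b) module \<Rightarrow> ('a, 'c) module \<Rightarrow> ('b \<times> 'c \<Rightarrow>\<^sub>0 int) set monoid" where
  "tensor_group R M N =
     free_Abelian_group (carrier M \<times> carrier N) Mod tensor_relations R M N"

text \<open>
  The map \<open>f \<otimes> id\<close> from \<open>M \<otimes> N\<close> to \<open>M' \<otimes> N\<close>. The union ranges over the representatives of a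
  single coset, all of which yield the same coset.
\<close>
definition tensor_map ::
  "('a, 'r) ring_scheme \<Rightarrow> ('a, 'b') module \<Rightarrow> ('a, 'c) module \<Rightarrow> ('b \<Rightarrow> 'b') \<Rightarrow>
   ('b \<times> 'c \<Rightarrow>\<^sub>0 int) set \<Rightarrow> ('b' \<times> 'c \<Rightarrow>\<^sub>0 int) set" where
  "tensor_map R M' N f C =
     (\<Union>u\<in>C. tensor_relations R M' N #>\<^bsub>free_Abelian_group (carrier M' \<times> carrier N)\<^esub>
        frag_extend (\<lambda>(x, y). frag_of (f x, y)) u)"

definition Hom_group ::
  "('a, 'r) ring_scheme \<Rightarrow> ('a, 'b) module \<Rightarrow> ('a, 'c) module \<Rightarrow> ('b \<Rightarrow> 'c) monoid" where
  "Hom_group R M N = \<lparr>carrier = linear_maps R M N \<inter> extensional (carrier M),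
     monoid.mult = (\<lambda>f g. \<lambda>x\<in>carrier M. f x \<oplus>\<^bsub>N\<^esub> g x), one = (\<lambda>x\<in>carrier M. \<zero>\<^bsub>N\<^esub>)\<rparr>"


section \<open>Tor and Ext\<close>

text \<open>The homology \<open>ker g / im f\<close> at \<open>H\<close> of \<open>G \<rightarrow> H \<rightarrow> K\<close>.\<close>
definition homology_at ::
  "'g monoid \<Rightarrow> 'h monoid \<Rightarrow> 'k monoid \<Rightarrow> ('g \<Rightarrow> 'h) \<Rightarrow> ('h \<Rightarrow> 'k) \<Rightarrow> 'h set monoid" where
  "homology_at G H K f g = (H\<lparr>carrier := kernel H K g\<rparr>) Mod (f ` carrier G)"

text \<open>
  \<open>Tor R P \<delta> N n\<close> is the \<open>n\<close>-th homology of \<open>P \<otimes> N\<close>, and \<open>Ext R P \<delta> N n\<close> the \<open>n\<close>-th cohomology of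
  \<open>Hom(P, N)\<close>. For a projective resolution \<open>P\<close> of \<open>M\<close> these are the groups \<open>Tor\<^sub>n(M, N)\<close> and
  \<open>Ext\<^sup>n(M, N)\<close>, which are determined up to isomorphism only; a statement about them therefore
  quantifies over all projective resolutions.
\<close>
definition Tor ::
  "('a, 'r) ring_scheme \<Rightarrow> (nat \<Rightarrow> ('a, 'p) module) \<Rightarrow> (nat \<Rightarrow> 'p \<Rightarrow> 'p) \<Rightarrow>
   ('a, 'c) module \<Rightarrow> nat \<Rightarrow> ('p \<times> 'c \<Rightarrow>\<^sub>0 int) set set monoid" where
  "Tor R P \<delta> N n =
     (let T = \<lambda>k. tensor_group R (P k) N; D = \<lambda>k. tensor_map R (P k) N (\<delta> k)
      in case n of
           0 \<Rightarrow> T 0 Mod (D 0 ` carrier (T 1))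
         | Suc m \<Rightarrow> homology_at (T (Suc n)) (T n) (T m) (D n) (D m))"

definition Ext ::
  "('a, 'r) ring_scheme \<Rightarrow> (nat \<Rightarrow> ('a, 'p) module) \<Rightarrow> (nat \<Rightarrow> 'p \<Rightarrow> 'p) \<Rightarrow>
   ('a, 'c) module \<Rightarrow> nat \<Rightarrow> ('p \<Rightarrow> 'c) set monoid" where
  "Ext R P \<delta> N n =
     (let H = \<lambda>k. Hom_group R (P k) N; D = \<lambda>k \<phi>. compose (carrier (P (Suc k))) \<phi> (\<delta> k)
      in case n of
           0 \<Rightarrow> (H 0)\<lparr>carrier := kernel (H 0) (H 1) (D 0)\<rparr> Mod {\<one>\<^bsub>H 0\<^esub>}
         | Suc m \<Rightarrow> homology_at (H m) (H n) (H (Suc n)) (D m) (D n))"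


section \<open>The rings\<close>

definition A_ideal :: "int \<Rightarrow> (nat \<Rightarrow> int) set" where
  "A_ideal d = PIdl\<^bsub>UP \<Z>\<^esub> (up_ring.monom (UP \<Z>) 1 2 \<ominus>\<^bsub>UP \<Z>\<^esub> up_ring.monom (UP \<Z>) (d\<^sup>2) 1)"

definition A_ring :: "int \<Rightarrow> (nat \<Rightarrow> int) set ring" where
  "A_ring d = UP \<Z> Quot A_ideal d"

definition t_elem :: "int \<Rightarrow> (nat \<Rightarrow> int) set" where
  "t_elem d = A_ideal d +>\<^bsub>UP \<Z>\<^esub> up_ring.monom (UP \<Z>) 1 1"

definition kappa :: "int \<Rightarrow> (nat \<Rightarrow> int) set" where
  "kappa d = t_elem d \<ominus>\<^bsub>A_ring d\<^esub> add_pow (A_ring d) (d\<^sup>2) \<one>\<^bsub>A_ring d\<^esub>"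

definition A_module :: "int \<Rightarrow> ((nat \<Rightarrow> int) set, (nat \<Rightarrow> int) set) module" where
  "A_module d = regular_module (A_ring d)"

definition R_module :: "int \<Rightarrow> ((nat \<Rightarrow> int) set, (nat \<Rightarrow> int) set set) module" where
  "R_module d = quotient_module (A_ring d) (PIdl\<^bsub>A_ring d\<^esub> (kappa d))"

definition R_proj :: "int \<Rightarrow> (nat \<Rightarrow> int) set \<Rightarrow> (nat \<Rightarrow> int) set set" where
  "R_proj d x = PIdl\<^bsub>A_ring d\<^esub> (kappa d) +>\<^bsub>A_ring d\<^esub> x"

definition periodic_differential :: "int \<Rightarrow> nat \<Rightarrow> (nat \<Rightarrow> int) set \<Rightarrow> (nat \<Rightarrow> int) set" where
  "periodic_differential d n x = (if even n then kappa d else t_elem d) \<otimes>\<^bsub>A_ring d\<^esub> x"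

end

theory Submission
  imports Defs
begin

text \<open>
  Any projective resolution \<open>P\<close> of \<open>R/\<kappa>\<close> is compared with the two-periodic one: there are linear maps
  \<open>g n : P n \<rightarrow> R\<close> lifting the identity, elements \<open>p n\<close> of \<open>P n\<close> (a chain map in the other direction is
  given by the images of \<open>1\<close>), and a homotopy from \<open>x \<mapsto> g n x \<cdot> p n\<close> to the identity of \<open>P\<close>. Hence every
  cycle of \<open>P \<otimes> N\<close> is homologous to \<open>p n \<otimes> r\<close> for some \<open>r\<close>, every cocycle \<open>\<phi>\<close> of \<open>Hom(P, N)\<close> is
  cohomologous to \<open>x \<mapsto> g n x \<cdot> \<phi> (p n)\<close>, and both groups reduce to \<open>N/tN\<close> or \<open>ker t\<close> as soon as
  \<open>\<kappa>\<close> kills \<open>N\<close>. The ring \<open>A\<close> embeds into \<open>\<int> \<times> \<int>\<close> by evaluation at \<open>0\<close> and \<open>d\<^sup>2\<close>, which yields the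
  annihilators of \<open>t\<close> and \<open>\<kappa>\<close>; evaluation at \<open>d\<^sup>2\<close> also identifies \<open>N = A/\<kappa>\<close> with \<open>\<int>\<close> so that \<open>t\<close>
  acts as \<open>d\<^sup>2\<close>.
\<close>

section \<open>Linear maps\<close>

text \<open>The claim ranges over all projective resolutions, with elements of an arbitrary type, so
  computing with the periodic resolution alone would prove too little. A full homotopy equivalence
  is avoided too: the homotopy is built only on the side of \<open>P\<close>. On the periodic side
  the round trip is multiplication by \<open>g n (p n)\<close>, which is merely shown to be
  congruent to 1 modulo the ideal generated by \<kappa> and \<open>t\<close>. That suffices, because
  \<kappa> acts as zero on N and \<open>t\<close> acts as zero on N/tN, the only nonzero group that
  occurs. Once \<kappa> kills N, tensoring the periodic resolution with N, or mapping it into N,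
  gives copies of N joined by 0 and \<open>t\<close> alternately. Tor and Ext differ only in the
  direction of the arrows, which shifts the degrees where N/tN appears. The remaining groups vanish
  because d is nonzero, so that d^2 acts injectively on the integers. The same fact keeps apart the
  two roots 0 and d^2 of X(X - d^2), on which the annihilators rest.\<close>

lemma linear_mapsI:
  assumes "\<And>x. x \<in> carrier M \<Longrightarrow> f x \<in> carrier N"
    and "\<And>x y. x \<in> carrier M \<Longrightarrow> y \<in> carrier M \<Longrightarrow> f (x \<oplus>\<^bsub>M\<^esub> y) = f x \<oplus>\<^bsub>N\<^esub> f y"
    and "\<And>a x. a \<in> carrier R \<Longrightarrow> x \<in> carrier M \<Longrightarrow> f (a \<odot>\<^bsub>M\<^esub> x) = a \<odot>\<^bsub>N\<^esub> f x"
  shows "f \<in> linear_maps R M N"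
  using assms by (auto simp: linear_maps_def)

lemma linear_maps_closed: "f \<in> linear_maps R M N \<Longrightarrow> x \<in> carrier M \<Longrightarrow> f x \<in> carrier N"
  by (auto simp: linear_maps_def)

lemma linear_maps_add:
  "f \<in> linear_maps R M N \<Longrightarrow> x \<in> carrier M \<Longrightarrow> y \<in> carrier M \<Longrightarrow> f (x \<oplus>\<^bsub>M\<^esub> y) = f x \<oplus>\<^bsub>N\<^esub> f y"
  by (auto simp: linear_maps_def)

lemma linear_maps_smult:
  "f \<in> linear_maps R M N \<Longrightarrow> a \<in> carrier R \<Longrightarrow> x \<in> carrier M \<Longrightarrow> f (a \<odot>\<^bsub>M\<^esub> x) = a \<odot>\<^bsub>N\<^esub> f x"
  by (auto simp: linear_maps_def)

lemma module_imp_abelian_group: "module R M \<Longrightarrow> abelian_group M"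
  by (simp add: module_def)

text \<open>\<open>linear_maps\<close> is a bare set of functions; this brings its elements under
  the theory of abelian group homomorphisms, from which zeros and differences are inherited.\<close>

lemma linear_maps_imp_abelian_group_hom:
  assumes "module R M" "module R N" "f \<in> linear_maps R M N"
  shows "abelian_group_hom M N f"
  using assms
  by (intro abelian_group_homI)
    (auto simp: module_imp_abelian_group hom_def linear_maps_def group_hom_def
      group_hom_axioms_def intro!: abelian_group.a_group)

lemma linear_maps_zero:
  assumes "module R M" "module R N" "f \<in> linear_maps R M N"
  shows "f \<zero>\<^bsub>M\<^esub> = \<zero>\<^bsub>N\<^esub>"
  using linear_maps_imp_abelian_group_hom[OF assms] by (rule abelian_group_hom.hom_zero)

lemma linear_maps_minus:
  assumes "module R M" "module R N" "f \<in> linear_maps R M N" "x \<in> carrier M" "y \<in> carrier M"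
  shows "f (x \<ominus>\<^bsub>M\<^esub> y) = f x \<ominus>\<^bsub>N\<^esub> f y"
proof -
  interpret abelian_group_hom M N f
    using assms(1-3) by (rule linear_maps_imp_abelian_group_hom)
  show ?thesis
    using assms(4,5) by (simp add: a_minus_def)
qed

lemma linear_maps_comp:
  assumes "f \<in> linear_maps R M N" "g \<in> linear_maps R N L"
  shows "(\<lambda>x. g (f x)) \<in> linear_maps R M L"
  using assms by (auto simp: linear_maps_def Pi_iff)

lemma linear_maps_diff:
  assumes "module R N" "f \<in> linear_maps R M N" "g \<in> linear_maps R M N"
  shows "(\<lambda>x. f x \<ominus>\<^bsub>N\<^esub> g x) \<in> linear_maps R M N"
proof -
  interpret N: module R N by fact
  show ?thesis
    using assms(2,3)
    by (intro linear_mapsI)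
      (auto simp: linear_maps_closed linear_maps_add linear_maps_smult a_minus_def N.smult_r_distr
        N.smult_r_minus N.minus_add N.a_ac)
qed

lemma regular_module_simps [simp]:
  "carrier (regular_module R) = carrier R" "\<zero>\<^bsub>regular_module R\<^esub> = \<zero>\<^bsub>R\<^esub>"
  "x \<oplus>\<^bsub>regular_module R\<^esub> y = x \<oplus>\<^bsub>R\<^esub> y" "a \<odot>\<^bsub>regular_module R\<^esub> x = a \<otimes>\<^bsub>R\<^esub> x"
  by (simp_all add: regular_module_def)

lemma linear_maps_smult_const:
  assumes "module R M" "f \<in> linear_maps R L (regular_module R)" "x \<in> carrier M"
  shows "(\<lambda>y. f y \<odot>\<^bsub>M\<^esub> x) \<in> linear_maps R L M"
proof -
  interpret M: module R M by fact
  show ?thesis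
    using assms(3) linear_maps_closed[OF assms(2)]
    by (intro linear_mapsI)
      (auto simp: linear_maps_add[OF assms(2)] linear_maps_smult[OF assms(2)]
        M.smult_l_distr M.smult_assoc1)
qed

section \<open>Linear maps out of free and projective modules\<close>

lemma (in module) finsum_smult_add:
  assumes "c \<in> S \<rightarrow> carrier R" "c' \<in> S \<rightarrow> carrier R" "v \<in> S \<rightarrow> carrier M"
  shows "(\<Oplus>\<^bsub>M\<^esub>b\<in>S. (c b \<oplus> c' b) \<odot>\<^bsub>M\<^esub> v b) =
    (\<Oplus>\<^bsub>M\<^esub>b\<in>S. c b \<odot>\<^bsub>M\<^esub> v b) \<oplus>\<^bsub>M\<^esub> (\<Oplus>\<^bsub>M\<^esub>b\<in>S. c' b \<odot>\<^bsub>M\<^esub> v b)"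
proof -
  have "(\<Oplus>\<^bsub>M\<^esub>b\<in>S. (c b \<oplus> c' b) \<odot>\<^bsub>M\<^esub> v b) = (\<Oplus>\<^bsub>M\<^esub>b\<in>S. c b \<odot>\<^bsub>M\<^esub> v b \<oplus>\<^bsub>M\<^esub> c' b \<odot>\<^bsub>M\<^esub> v b)"
    using assms by (intro finsum_cong') (auto simp: smult_l_distr Pi_iff)
  also have "\<dots> = (\<Oplus>\<^bsub>M\<^esub>b\<in>S. c b \<odot>\<^bsub>M\<^esub> v b) \<oplus>\<^bsub>M\<^esub> (\<Oplus>\<^bsub>M\<^esub>b\<in>S. c' b \<odot>\<^bsub>M\<^esub> v b)"
    using assms by (intro finsum_addf) (auto simp: Pi_iff)
  finally show ?thesis .
qed

text \<open>Coordinates with respect to B are unique, so x can be sent to the combination of the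
  \<open>v b\<close> with the coordinates of x. Linearity is uniqueness once more: sums and
  multiples of coordinate functions represent the sum and the multiple.\<close>

lemma is_basis_lift:
  fixes F :: "('a, 'b) module" and N :: "('a, 'c) module"
  assumes F: "module R F" and B: "is_basis R F B" and N: "module R N"
    and v: "\<And>b. b \<in> B \<Longrightarrow> v b \<in> carrier N"
  obtains f where "f \<in> linear_maps R F N" "\<And>b. b \<in> B \<Longrightarrow> f b = v b"
proof -
  interpret F: module R F by fact
  interpret N: module R N by fact
  define supp where "supp c = {b. c b \<noteq> \<zero>\<^bsub>R\<^esub>}" for c :: "'b \<Rightarrow> 'a"
  define coord where "coord c \<longleftrightarrow> c \<in> UNIV \<rightarrow> carrier R \<and> finite (supp c) \<and> supp c \<subseteq> B" for c
  define comb where "comb c = (\<Oplus>\<^bsub>F\<^esub>b\<in>supp c. c b \<odot>\<^bsub>F\<^esub> b)" for c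
  define val where "val c = (\<Oplus>\<^bsub>N\<^esub>b\<in>supp c. c b \<odot>\<^bsub>N\<^esub> v b)" for c
  have BF: "B \<subseteq> carrier F"
    using B by (simp add: is_basis_def)
  have ex1: "\<exists>!c. coord c \<and> x = comb c" if "x \<in> carrier F" for x
    using B that unfolding is_basis_def coord_def comb_def supp_def by auto
  \<comment> \<open>\<open>comb\<close> sums over the exact support, which can shrink when
    coordinates cancel. Additivity therefore compares all sums over one larger finite subset of
    B.\<close>
  have comb_superset: "comb c = (\<Oplus>\<^bsub>F\<^esub>b\<in>S. c b \<odot>\<^bsub>F\<^esub> b)"
    if "coord c" "finite S" "supp c \<subseteq> S" "S \<subseteq> B" for c S
    unfolding comb_def using that BF
    by (intro F.add.finprod_mono_neutral_cong_left) (auto simp: coord_def supp_def Pi_iff subset_iff)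
  have val_superset: "val c = (\<Oplus>\<^bsub>N\<^esub>b\<in>S. c b \<odot>\<^bsub>N\<^esub> v b)"
    if "coord c" "finite S" "supp c \<subseteq> S" "S \<subseteq> B" for c S
    unfolding val_def using that v
    by (intro N.add.finprod_mono_neutral_cong_left) (auto simp: coord_def supp_def Pi_iff subset_iff)
  have comb_closed: "comb c \<in> carrier F" if "coord c" for c
    unfolding comb_def using that BF by (intro F.finsum_closed) (auto simp: coord_def)
  have val_closed: "val c \<in> carrier N" if "coord c" for c
    unfolding val_def using that v by (intro N.finsum_closed) (auto simp: coord_def)
  have add: "coord (\<lambda>b. c b \<oplus>\<^bsub>R\<^esub> c' b) \<and> comb (\<lambda>b. c b \<oplus>\<^bsub>R\<^esub> c' b) = comb c \<oplus>\<^bsub>F\<^esub> comb c'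
      \<and> val (\<lambda>b. c b \<oplus>\<^bsub>R\<^esub> c' b) = val c \<oplus>\<^bsub>N\<^esub> val c'"
    if "coord c" "coord c'" for c c'
  proof -
    let ?S = "supp c \<union> supp c'"
    have S: "finite ?S" "?S \<subseteq> B" and cR: "\<And>b. c b \<in> carrier R" "\<And>b. c' b \<in> carrier R"
      using that by (auto simp: coord_def)
    have sub: "supp (\<lambda>b. c b \<oplus>\<^bsub>R\<^esub> c' b) \<subseteq> ?S"
      using cR by (auto simp: supp_def)
    have co: "coord (\<lambda>b. c b \<oplus>\<^bsub>R\<^esub> c' b)"
      using S sub cR finite_subset[OF sub] by (auto simp: coord_def)
    show ?thesis
      using co S sub cR that BF v
      by (auto simp: comb_superset[of _ ?S] val_superset[of _ ?S] Pi_iff subset_iff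
          intro!: F.finsum_smult_add[where v="\<lambda>b. b"] N.finsum_smult_add)
  qed
  have sm: "coord (\<lambda>b. a \<otimes>\<^bsub>R\<^esub> c b) \<and> comb (\<lambda>b. a \<otimes>\<^bsub>R\<^esub> c b) = a \<odot>\<^bsub>F\<^esub> comb c
      \<and> val (\<lambda>b. a \<otimes>\<^bsub>R\<^esub> c b) = a \<odot>\<^bsub>N\<^esub> val c"
    if "coord c" "a \<in> carrier R" for a c
  proof -
    let ?S = "supp c"
    have S: "finite ?S" "?S \<subseteq> B" and cR: "\<And>b. c b \<in> carrier R"
      using that by (auto simp: coord_def)
    have sub: "supp (\<lambda>b. a \<otimes>\<^bsub>R\<^esub> c b) \<subseteq> ?S"
      using cR that by (auto simp: supp_def)
    have co: "coord (\<lambda>b. a \<otimes>\<^bsub>R\<^esub> c b)"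
      using S sub cR that finite_subset[OF sub] by (auto simp: coord_def)
    show ?thesis
      using co S sub cR that BF v
      by (auto simp: comb_superset[of _ ?S] val_superset[of _ ?S] F.smult_assoc1 N.smult_assoc1
          Pi_iff subset_iff F.finsum_smult_ldistr N.finsum_smult_ldistr
          intro!: F.finsum_cong' N.finsum_cong')
  qed
  define co where "co x = (THE c. coord c \<and> x = comb c)" for x
  have co: "coord (co x)" "comb (co x) = x" if "x \<in> carrier F" for x
    using theI'[OF ex1[OF that]] by (auto simp: co_def)
  have co_eq: "co (comb c) = c" if "coord c" for c
    using ex1[OF comb_closed[OF that]] co[OF comb_closed[OF that]] that by auto
  show thesis
  proof
    show "(\<lambda>x. val (co x)) \<in> linear_maps R F N"
    proof (rule linear_mapsI)
      fix x y assume xy: "x \<in> carrier F" "y \<in> carrier F"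
      have "co (x \<oplus>\<^bsub>F\<^esub> y) = (\<lambda>b. co x b \<oplus>\<^bsub>R\<^esub> co y b)"
        using add[OF co(1)[OF xy(1)] co(1)[OF xy(2)]] co_eq co(2) xy by metis
      then show "val (co (x \<oplus>\<^bsub>F\<^esub> y)) = val (co x) \<oplus>\<^bsub>N\<^esub> val (co y)"
        using add[OF co(1)[OF xy(1)] co(1)[OF xy(2)]] by simp
    next
      fix a x assume ax: "a \<in> carrier R" "x \<in> carrier F"
      have "co (a \<odot>\<^bsub>F\<^esub> x) = (\<lambda>b. a \<otimes>\<^bsub>R\<^esub> co x b)"
        using sm[OF co(1)[OF ax(2)] ax(1)] co_eq co(2) ax by metis
      then show "val (co (a \<odot>\<^bsub>F\<^esub> x)) = a \<odot>\<^bsub>N\<^esub> val (co x)"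
        using sm[OF co(1)[OF ax(2)] ax(1)] by simp
    qed (simp add: co val_closed)
    fix b assume b: "b \<in> B"
    let ?e = "\<lambda>b'. if b' = b then \<one>\<^bsub>R\<^esub> else \<zero>\<^bsub>R\<^esub>"
    \<comment> \<open>Only an inclusion: the support is empty when \<open>R\<close> is the zero
      ring.\<close>
    have sub: "supp ?e \<subseteq> {b}"
      by (auto simp: supp_def)
    then have e: "coord ?e"
      using b finite_subset[OF sub] by (auto simp: coord_def)
    have bF: "b \<in> carrier F"
      using b BF by auto
    have "comb ?e = b"
      using comb_superset[OF e _ sub] b bF by (simp add: F.finsum_insert)
    moreover have "val ?e = v b"
      using val_superset[OF e _ sub] b v[OF b] by (simp add: N.finsum_insert)
    ultimately show "val (co b) = v b"
      using co_eq[OF e] by simp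
  qed
qed

text \<open>Lift on a basis of the free module F of which P is a retract, then restrict along i. The
  lifting condition concerns only the values of h; this lets b be a differential and h take values
  in its boundaries, with no submodule formed.\<close>

lemma projective_module_lift:
  fixes P :: "('a, 'p) module"
  assumes P: "projective_module R P" and M: "module R M" and N: "module R N"
    and b: "b \<in> linear_maps R M N" and h: "h \<in> linear_maps R P N"
    and im: "\<And>x. x \<in> carrier P \<Longrightarrow> h x \<in> b ` carrier M"
  obtains f where "f \<in> linear_maps R P M" "\<And>x. x \<in> carrier P \<Longrightarrow> b (f x) = h x"
proof -
  obtain F :: "('a, 'p \<Rightarrow> 'a) module" and i p where F: "free_module R F"
    and i: "i \<in> linear_maps R P F" and p: "p \<in> linear_maps R F P"
    and pi: "\<And>x. x \<in> carrier P \<Longrightarrow> p (i x) = x"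
    using P unfolding projective_module_def by blast
  obtain B where Fm: "module R F" and B: "is_basis R F B"
    using F unfolding free_module_def by blast
  have BF: "B \<subseteq> carrier F"
    using B by (simp add: is_basis_def)
  interpret F: module R F by fact
  interpret N: module R N by fact
  have "\<exists>m. m \<in> carrier M \<and> b m = h (p e)" if "e \<in> B" for e
    using im[of "p e"] linear_maps_closed[OF p] BF that by (metis image_iff subsetD)
  then obtain v where v: "\<And>e. e \<in> B \<Longrightarrow> v e \<in> carrier M" "\<And>e. e \<in> B \<Longrightarrow> b (v e) = h (p e)"
    by metis
  obtain f where f: "f \<in> linear_maps R F M" "\<And>e. e \<in> B \<Longrightarrow> f e = v e"
    using is_basis_lift[OF Fm B M, of v] v(1) by metis
  have agree: "b (f x) = h (p x)" if x: "x \<in> carrier F" for x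
  proof -
    obtain c where c: "c \<in> UNIV \<rightarrow> carrier R" "finite {b. c b \<noteq> \<zero>\<^bsub>R\<^esub>}" "{b. c b \<noteq> \<zero>\<^bsub>R\<^esub>} \<subseteq> B"
      and xc: "x = (\<Oplus>\<^bsub>F\<^esub>b\<in>{b. c b \<noteq> \<zero>\<^bsub>R\<^esub>}. c b \<odot>\<^bsub>F\<^esub> b)"
      using B x unfolding is_basis_def by blast
    \<comment> \<open>A linear map commutes with finite combinations. Applied to b after f and to h
      after p, which agree on B, this gives agreement on all of F.\<close>
    have *: "k (\<Oplus>\<^bsub>F\<^esub>b\<in>S. c b \<odot>\<^bsub>F\<^esub> b) = (\<Oplus>\<^bsub>N\<^esub>b\<in>S. c b \<odot>\<^bsub>N\<^esub> k b)"
      if k: "k \<in> linear_maps R F N" and S: "finite S" "S \<subseteq> B" for k S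
      using S
    proof (induction S)
      case empty
      show ?case using linear_maps_zero[OF Fm N k] by simp
    next
      case (insert e S)
      have "(\<lambda>b. c b \<odot>\<^bsub>F\<^esub> b) \<in> S \<rightarrow> carrier F" "(\<lambda>b. c b \<odot>\<^bsub>N\<^esub> k b) \<in> S \<rightarrow> carrier N" "e \<in> carrier F"
        using insert.prems BF c(1) linear_maps_closed[OF k] by (auto simp: Pi_iff)
      then show ?case
        using insert c(1) k
        by (simp add: F.finsum_insert N.finsum_insert linear_maps_add[OF k] linear_maps_smult[OF k]
            linear_maps_closed[OF k] Pi_iff)
    qed
    have k1: "(\<lambda>x. b (f x)) \<in> linear_maps R F N" and k2: "(\<lambda>x. h (p x)) \<in> linear_maps R F N"
      using linear_maps_comp[OF f(1) b] linear_maps_comp[OF p h] by auto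
    show ?thesis
      unfolding xc *[OF k1 c(2,3)] *[OF k2 c(2,3)] using f(2) v(2) c(1,3) BF linear_maps_closed[OF k2]
      by (intro N.finsum_cong') (auto simp: Pi_iff subset_iff)
  qed
  show thesis
    by (rule that[OF linear_maps_comp[OF i f(1)]]) (simp add: agree linear_maps_closed[OF i] pi)
qed

section \<open>Comparison of resolutions\<close>

context
  fixes R :: "('a, 'r) ring_scheme" and P :: "nat \<Rightarrow> ('a, 'p) module"
    and \<delta> :: "nat \<Rightarrow> 'p \<Rightarrow> 'p" and \<epsilon> :: "'p \<Rightarrow> 'm" and M :: "('a, 'm) module"
  assumes res: "resolution R P \<delta> \<epsilon> M"
begin

lemma resolution_module: "module R (P n)"
  using res by (simp add: resolution_def)

lemma resolution_module_target: "module R M"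
  using res by (simp add: resolution_def)

lemma resolution_linear: "\<delta> n \<in> linear_maps R (P (Suc n)) (P n)"
  using res by (simp add: resolution_def)

lemma resolution_linear_augmentation: "\<epsilon> \<in> linear_maps R (P 0) M"
  using res by (simp add: resolution_def)

lemma resolution_surj: "\<epsilon> ` carrier (P 0) = carrier M"
  using res by (simp add: resolution_def)

lemma resolution_exact:
  assumes "x \<in> carrier (P (Suc n))" "\<delta> n x = \<zero>\<^bsub>P n\<^esub>"
  shows "x \<in> \<delta> (Suc n) ` carrier (P (Suc (Suc n)))"
  using res assms by (simp add: resolution_def a_kernel_def')

lemma resolution_exact_0:
  assumes "x \<in> carrier (P 0)" "\<epsilon> x = \<zero>\<^bsub>M\<^esub>"
  shows "x \<in> \<delta> 0 ` carrier (P (Suc 0))"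
  using res assms by (simp add: resolution_def a_kernel_def')

lemma resolution_complex:
  assumes "x \<in> carrier (P (Suc (Suc n)))"
  shows "\<delta> n (\<delta> (Suc n) x) = \<zero>\<^bsub>P n\<^esub>"
proof -
  have "\<delta> (Suc n) x \<in> a_kernel (P (Suc n)) (P n) (\<delta> n)"
    using res assms unfolding resolution_def by blast
  then show ?thesis by (simp add: a_kernel_def')
qed

lemma resolution_complex_0:
  assumes "x \<in> carrier (P (Suc 0))"
  shows "\<epsilon> (\<delta> 0 x) = \<zero>\<^bsub>M\<^esub>"
proof -
  have "\<delta> 0 x \<in> a_kernel (P 0) M \<epsilon>"
    using res assms unfolding resolution_def One_nat_def by blast
  then show ?thesis by (simp add: a_kernel_def')
qed

end

text \<open>The classical comparison map, built degree by degree: \<open>P\<close> supplies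
  projectivity, \<open>Q\<close> exactness.\<close>

lemma resolution_lift_identity:
  assumes P: "resolution R P \<delta> \<epsilon> M" and proj: "\<And>n. projective_module R (P n)"
    and Q: "resolution R Q \<delta>' \<epsilon>' M"
  obtains g where "\<And>n. g n \<in> linear_maps R (P n) (Q n)"
    and "\<And>x. x \<in> carrier (P 0) \<Longrightarrow> \<epsilon>' (g 0 x) = \<epsilon> x"
    and "\<And>n x. x \<in> carrier (P (Suc n)) \<Longrightarrow> \<delta>' n (g (Suc n) x) = g n (\<delta> n x)"
proof -
  note dP = resolution_linear[OF P] and dQ = resolution_linear[OF Q]
    and mP = resolution_module[OF P] and mQ = resolution_module[OF Q]
  \<comment> \<open>The middle clause is the image condition that
    \<open>projective_module_lift\<close> asks for in the next degree. The last clause rides along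
    because the dependent choice returns only the invariant and the relation between successive
    maps.\<close>
  define I where "I n g \<longleftrightarrow> g \<in> linear_maps R (P n) (Q n)
    \<and> (\<forall>x\<in>carrier (P (Suc n)). g (\<delta> n x) \<in> \<delta>' n ` carrier (Q (Suc n)))
    \<and> (n = 0 \<longrightarrow> (\<forall>x\<in>carrier (P 0). \<epsilon>' (g x) = \<epsilon> x))" for n g
  obtain g0 where g0: "g0 \<in> linear_maps R (P 0) (Q 0)"
    "\<And>x. x \<in> carrier (P 0) \<Longrightarrow> \<epsilon>' (g0 x) = \<epsilon> x"
    by (rule projective_module_lift[OF proj mQ resolution_module_target[OF Q]
          resolution_linear_augmentation[OF Q] resolution_linear_augmentation[OF P]])
      (use resolution_surj[OF Q] linear_maps_closed[OF resolution_linear_augmentation[OF P]] in auto)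
  have "I 0 g0"
    unfolding I_def using g0
    by (auto intro!: resolution_exact_0[OF Q]
        simp: linear_maps_closed[OF g0(1)] linear_maps_closed[OF dP] resolution_complex_0[OF P])
  moreover have "\<exists>g'. I (Suc n) g' \<and> (\<forall>x\<in>carrier (P (Suc n)). \<delta>' n (g' x) = g (\<delta> n x))"
    if g: "I n g" for n g
  proof -
    have gl: "g \<in> linear_maps R (P n) (Q n)"
      using g by (simp add: I_def)
    obtain g' where g': "g' \<in> linear_maps R (P (Suc n)) (Q (Suc n))"
      "\<And>x. x \<in> carrier (P (Suc n)) \<Longrightarrow> \<delta>' n (g' x) = g (\<delta> n x)"
      by (rule projective_module_lift[OF proj mQ mQ dQ linear_maps_comp[OF dP gl]])
        (use g in \<open>auto simp: I_def\<close>)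
    have "g' (\<delta> (Suc n) x) \<in> \<delta>' (Suc n) ` carrier (Q (Suc (Suc n)))"
      if "x \<in> carrier (P (Suc (Suc n)))" for x
      using that linear_maps_closed[OF dP]
      by (intro resolution_exact[OF Q])
        (auto simp: linear_maps_closed[OF g'(1)] g'(2) resolution_complex[OF P]
          linear_maps_zero[OF mP mQ gl])
    with g' show ?thesis
      unfolding I_def by auto
  qed
  ultimately obtain g where "\<And>n. I n (g n)"
    "\<And>n. \<forall>x\<in>carrier (P (Suc n)). \<delta>' n (g (Suc n) x) = g n (\<delta> n x)"
    using dependent_nat_choice[of I "\<lambda>n g g'. \<forall>x\<in>carrier (P (Suc n)). \<delta>' n (g' x) = g (\<delta> n x)"]
    by metis
  then show thesis
    by (intro that[of g]) (auto simp: I_def)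
qed

text \<open>Each component of the homotopy lifts what the previous one leaves over, which is a cycle
  and hence a boundary. It is applied below with both resolutions equal to \<open>P\<close>.\<close>

lemma resolution_null_homotopic:
  assumes P: "resolution R P \<delta> \<epsilon> M" and proj: "\<And>n. projective_module R (P n)"
    and Q: "resolution R Q \<delta>' \<epsilon>' N"
    and h: "\<And>n. h n \<in> linear_maps R (P n) (Q n)"
    and h0: "\<And>x. x \<in> carrier (P 0) \<Longrightarrow> \<epsilon>' (h 0 x) = \<zero>\<^bsub>N\<^esub>"
    and chain: "\<And>n x. x \<in> carrier (P (Suc n)) \<Longrightarrow> \<delta>' n (h (Suc n) x) = h n (\<delta> n x)"
  obtains s where "\<And>n. s n \<in> linear_maps R (P n) (Q (Suc n))"
    and "\<And>n x. x \<in> carrier (P (Suc n)) \<Longrightarrow>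
           h (Suc n) x = \<delta>' (Suc n) (s (Suc n) x) \<oplus>\<^bsub>Q (Suc n)\<^esub> s n (\<delta> n x)"
proof -
  note dP = resolution_linear[OF P] and dQ = resolution_linear[OF Q]
    and mP = resolution_module[OF P] and mQ = resolution_module[OF Q]
  \<comment> \<open>The part of h in degree n+1 that s leaves to be written as a boundary.\<close>
  define r where "r n s x = h (Suc n) x \<ominus>\<^bsub>Q (Suc n)\<^esub> s (\<delta> n x)" for n s x
  define I where "I n s \<longleftrightarrow> s \<in> linear_maps R (P n) (Q (Suc n))
    \<and> (\<forall>x\<in>carrier (P (Suc n)). r n s x \<in> \<delta>' (Suc n) ` carrier (Q (Suc (Suc n))))" for n s
  define S where "S n s s' \<longleftrightarrow> (\<forall>x\<in>carrier (P (Suc n)). \<delta>' (Suc n) (s' x) = r n s x)" for n s s'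
  have r_linear: "r n s \<in> linear_maps R (P (Suc n)) (Q (Suc n))"
    if "s \<in> linear_maps R (P n) (Q (Suc n))" for n s
    unfolding r_def using linear_maps_diff[OF mQ h linear_maps_comp[OF dP that]] .
  have \<delta>_r: "\<delta>' n (r n s x) = h n (\<delta> n x) \<ominus>\<^bsub>Q n\<^esub> \<delta>' n (s (\<delta> n x))"
    if "s \<in> linear_maps R (P n) (Q (Suc n))" "x \<in> carrier (P (Suc n))" for n s x
    unfolding r_def using that
    by (simp add: linear_maps_minus[OF mQ mQ dQ] linear_maps_closed[OF h] linear_maps_closed[OF dP]
        linear_maps_closed chain)
  obtain s0 where s0: "s0 \<in> linear_maps R (P 0) (Q (Suc 0))"
    "\<And>x. x \<in> carrier (P 0) \<Longrightarrow> \<delta>' 0 (s0 x) = h 0 x"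
    by (rule projective_module_lift[OF proj mQ mQ dQ h])
      (auto intro!: resolution_exact_0[OF Q] simp: h0 linear_maps_closed[OF h])
  have "I 0 s0"
    unfolding I_def
  proof (intro conjI ballI resolution_exact[OF Q])
    fix x assume x: "x \<in> carrier (P (Suc 0))"
    interpret Q0: module R "Q 0" by (rule mQ)
    show "\<delta>' 0 (r 0 s0 x) = \<zero>\<^bsub>Q 0\<^esub>"
      using x s0(2) linear_maps_closed[OF dP x] linear_maps_closed[OF h]
      by (simp add: \<delta>_r[OF s0(1) x] Q0.minus_eq Q0.r_neg)
  qed (use s0 linear_maps_closed[OF r_linear] in auto)
  moreover have "\<exists>s'. I (Suc n) s' \<and> S n s s'" if s: "I n s" for n s
  proof -
    have sl: "s \<in> linear_maps R (P n) (Q (Suc n))"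
      using s by (simp add: I_def)
    obtain s' where s': "s' \<in> linear_maps R (P (Suc n)) (Q (Suc (Suc n)))"
      "\<And>x. x \<in> carrier (P (Suc n)) \<Longrightarrow> \<delta>' (Suc n) (s' x) = r n s x"
      by (rule projective_module_lift[OF proj mQ mQ dQ r_linear[OF sl]])
        (use s in \<open>auto simp: I_def\<close>)
    have "I (Suc n) s'"
      unfolding I_def
    proof (intro conjI ballI resolution_exact[OF Q])
      fix x assume x: "x \<in> carrier (P (Suc (Suc n)))"
      interpret Q: module R "Q (Suc n)" by (rule mQ)
      have dx: "\<delta> (Suc n) x \<in> carrier (P (Suc n))"
        using linear_maps_closed[OF dP x] .
      \<comment> \<open>\<open>s'\<close> lifts \<open>r n s\<close>, and on a boundary the s-term
        of \<open>r n s\<close> vanishes because it contains two successive differentials.\<close>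
      have "\<delta>' (Suc n) (s' (\<delta> (Suc n) x)) = h (Suc n) (\<delta> (Suc n) x)"
        using dx by (simp add: s'(2) r_def resolution_complex[OF P x] linear_maps_zero[OF mP mQ sl]
            linear_maps_closed[OF h] Q.minus_eq)
      then show "\<delta>' (Suc n) (r (Suc n) s' x) = \<zero>\<^bsub>Q (Suc n)\<^esub>"
        using dx by (simp add: \<delta>_r[OF s'(1) x] linear_maps_closed[OF h] Q.minus_eq Q.r_neg)
    qed (use s' linear_maps_closed[OF r_linear] in auto)
    with s' show ?thesis
      unfolding S_def by blast
  qed
  ultimately obtain s where s: "\<And>n. I n (s n)" "\<And>n. S n (s n) (s (Suc n))"
    using dependent_nat_choice[of I S] by metis
  have sl: "s n \<in> linear_maps R (P n) (Q (Suc n))" for n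
    using s(1) by (simp add: I_def)
  show thesis
  proof (rule that[OF sl])
    fix n x assume x: "x \<in> carrier (P (Suc n))"
    interpret Q: module R "Q (Suc n)" by (rule mQ)
    show "h (Suc n) x = \<delta>' (Suc n) (s (Suc n) x) \<oplus>\<^bsub>Q (Suc n)\<^esub> s n (\<delta> n x)"
      using s(2)[of n] x linear_maps_closed[OF sl linear_maps_closed[OF dP x]] linear_maps_closed[OF h x]
      by (simp add: S_def r_def Q.minus_eq Q.a_assoc Q.l_neg)
  qed
qed

section \<open>Tensor products\<close>

definition pure_tensor ::
  "('a, 'r) ring_scheme \<Rightarrow> ('a, 'b) module \<Rightarrow> ('a, 'c) module \<Rightarrow> 'b \<Rightarrow> 'c \<Rightarrow> ('b \<times> 'c \<Rightarrow>\<^sub>0 int) set"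
  where "pure_tensor R M N x y =
    tensor_relations R M N #>\<^bsub>free_Abelian_group (carrier M \<times> carrier N)\<^esub> frag_of (x, y)"

text \<open>Kernels are subgroups, so it suffices that h kills each generating relation. Both the
  universal property and the well-definedness of \<open>tensor_map\<close> factor a homomorphism
  through the quotient in this way.\<close>

lemma tensor_relations_least:
  assumes "module R M" "module R N" and K: "group K"
    and h: "h \<in> hom (free_Abelian_group (carrier M \<times> carrier N)) K"
    and addl: "\<And>x x' y. x \<in> carrier M \<Longrightarrow> x' \<in> carrier M \<Longrightarrow> y \<in> carrier N \<Longrightarrow>
        h (frag_of (x \<oplus>\<^bsub>M\<^esub> x', y)) = h (frag_of (x, y)) \<otimes>\<^bsub>K\<^esub> h (frag_of (x', y))"
    and addr: "\<And>x y y'. x \<in> carrier M \<Longrightarrow> y \<in> carrier N \<Longrightarrow> y' \<in> carrier N \<Longrightarrow>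
        h (frag_of (x, y \<oplus>\<^bsub>N\<^esub> y')) = h (frag_of (x, y)) \<otimes>\<^bsub>K\<^esub> h (frag_of (x, y'))"
    and bal: "\<And>a x y. a \<in> carrier R \<Longrightarrow> x \<in> carrier M \<Longrightarrow> y \<in> carrier N \<Longrightarrow>
        h (frag_of (a \<odot>\<^bsub>M\<^esub> x, y)) = h (frag_of (x, a \<odot>\<^bsub>N\<^esub> y))"
  shows "tensor_relations R M N \<subseteq> kernel (free_Abelian_group (carrier M \<times> carrier N)) K h"
proof -
  let ?F = "free_Abelian_group (carrier M \<times> carrier N)"
  interpret M: module R M by fact
  interpret N: module R N by fact
  interpret F: comm_group ?F by (rule abelian_free_Abelian_group)
  interpret K: group K by fact
  interpret h: group_hom ?F K h
    using h by (simp add: group_hom_def group_hom_axioms_def K.is_group)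
  have cl: "h u \<in> carrier K" if "Poly_Mapping.keys u \<subseteq> carrier M \<times> carrier N" for u
    using h.hom_closed that by simp
  have diff: "Poly_Mapping.keys (u - v) \<subseteq> carrier M \<times> carrier N"
      "h (u - v) = h u \<otimes>\<^bsub>K\<^esub> inv\<^bsub>K\<^esub> h v"
    if "Poly_Mapping.keys u \<subseteq> carrier M \<times> carrier N" "Poly_Mapping.keys v \<subseteq> carrier M \<times> carrier N" for u v
  proof -
    show "Poly_Mapping.keys (u - v) \<subseteq> carrier M \<times> carrier N"
      using that keys_diff[of u v] by blast
    show "h (u - v) = h u \<otimes>\<^bsub>K\<^esub> inv\<^bsub>K\<^esub> h v"
      using h.hom_mult[of u "- v"] h.hom_inv[of v] that by simp
  qed
  have kern: "u - v \<in> kernel ?F K h"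
    if "Poly_Mapping.keys u \<subseteq> carrier M \<times> carrier N" "Poly_Mapping.keys v \<subseteq> carrier M \<times> carrier N"
      "h u = h v" for u v
    using that diff[OF that(1,2)] cl by (simp add: kernel_def)
  have kern2: "frag_of z - frag_of z' - frag_of z'' \<in> kernel ?F K h"
    if "z \<in> carrier M \<times> carrier N" "z' \<in> carrier M \<times> carrier N" "z'' \<in> carrier M \<times> carrier N"
      "h (frag_of z) = h (frag_of z') \<otimes>\<^bsub>K\<^esub> h (frag_of z'')" for z z' z''
  proof -
    \<comment> \<open>A three-term relation z - z' - z'' is read as z - (z' + z''), so that
      \<open>kern\<close> covers it as well.\<close>
    have "Poly_Mapping.keys (frag_of z' + frag_of z'') \<subseteq> carrier M \<times> carrier N"
      using that keys_add[of "frag_of z'" "frag_of z''"] by auto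
    moreover have "h (frag_of z' + frag_of z'') = h (frag_of z)"
      using that h.hom_mult[of "frag_of z'" "frag_of z''"] by simp
    ultimately show ?thesis
      unfolding diff_diff_eq using that(1) by (intro kern) auto
  qed
  show ?thesis
    unfolding tensor_relations_def
    by (rule F.generate_subgroup_incl[OF _ h.subgroup_kernel])
      (safe; (rule kern2 | rule kern); auto simp: addl addr bal)
qed

context
  fixes R :: "('a, 'r) ring_scheme" and M :: "('a, 'b) module" and N :: "('a, 'c) module"
  assumes M: "module R M" and N: "module R N"
begin

interpretation M: module R M by (rule M)
interpretation N: module R N by (rule N)
interpretation F: comm_group "free_Abelian_group (carrier M \<times> carrier N)"
  by (rule abelian_free_Abelian_group)

lemma tensor_relators_closed:
  "{frag_of (x \<oplus>\<^bsub>M\<^esub> x', y) - frag_of (x, y) - frag_of (x', y) | x x' y.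
      x \<in> carrier M \<and> x' \<in> carrier M \<and> y \<in> carrier N} \<union>
   {frag_of (x, y \<oplus>\<^bsub>N\<^esub> y') - frag_of (x, y) - frag_of (x, y') | x y y'.
      x \<in> carrier M \<and> y \<in> carrier N \<and> y' \<in> carrier N} \<union>
   {frag_of (a \<odot>\<^bsub>M\<^esub> x, y) - frag_of (x, a \<odot>\<^bsub>N\<^esub> y) | a x y.
      a \<in> carrier R \<and> x \<in> carrier M \<and> y \<in> carrier N}
   \<subseteq> carrier (free_Abelian_group (carrier M \<times> carrier N))" (is "?rel \<subseteq> _")
proof -
  have diff: "u - v \<in> carrier (free_Abelian_group S)"
    if "u \<in> carrier (free_Abelian_group S)" "v \<in> carrier (free_Abelian_group S)"
    for u v :: "'b \<times> 'c \<Rightarrow>\<^sub>0 int" and S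
    using that keys_diff[of u v] by auto
  show ?thesis
    by (safe; intro diff) auto
qed

lemma tensor_relations_subgroup:
  "subgroup (tensor_relations R M N) (free_Abelian_group (carrier M \<times> carrier N))"
  unfolding tensor_relations_def by (rule F.generate_is_subgroup[OF tensor_relators_closed])

lemma tensor_relations_normal:
  "tensor_relations R M N \<lhd> free_Abelian_group (carrier M \<times> carrier N)"
  by (rule F.subgroup_imp_normal[OF tensor_relations_subgroup])

lemma tensor_group_comm_group: "comm_group (tensor_group R M N)"
  unfolding tensor_group_def by (rule F.abelian_FactGroup[OF tensor_relations_subgroup])

lemma tensor_projection_hom:
  "(\<lambda>u. tensor_relations R M N #>\<^bsub>free_Abelian_group (carrier M \<times> carrier N)\<^esub> u)
     \<in> hom (free_Abelian_group (carrier M \<times> carrier N)) (tensor_group R M N)"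
  unfolding tensor_group_def by (rule normal.r_coset_hom_Mod[OF tensor_relations_normal])

lemma pure_tensor_closed [simp]:
  "x \<in> carrier M \<Longrightarrow> y \<in> carrier N \<Longrightarrow> pure_tensor R M N x y \<in> carrier (tensor_group R M N)"
  unfolding pure_tensor_def by (rule hom_in_carrier[OF tensor_projection_hom]) simp

lemma tensor_coset_eqI:
  assumes "u - v \<in> tensor_relations R M N" "Poly_Mapping.keys v \<subseteq> carrier M \<times> carrier N"
  shows "tensor_relations R M N #>\<^bsub>free_Abelian_group (carrier M \<times> carrier N)\<^esub> u
    = tensor_relations R M N #>\<^bsub>free_Abelian_group (carrier M \<times> carrier N)\<^esub> v"
proof -
  have "u \<in> tensor_relations R M N #>\<^bsub>free_Abelian_group (carrier M \<times> carrier N)\<^esub> v"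
    using assms(1) by (force simp: r_coset_def)
  from F.repr_independence[OF this _ tensor_relations_subgroup] assms(2) show ?thesis
    by simp
qed

lemma pure_tensor_add_left:
  assumes "x \<in> carrier M" "x' \<in> carrier M" "y \<in> carrier N"
  shows "pure_tensor R M N (x \<oplus>\<^bsub>M\<^esub> x') y
    = pure_tensor R M N x y \<otimes>\<^bsub>tensor_group R M N\<^esub> pure_tensor R M N x' y"
proof -
  have "frag_of (x \<oplus>\<^bsub>M\<^esub> x', y) - (frag_of (x, y) + frag_of (x', y)) \<in> tensor_relations R M N"
    unfolding tensor_relations_def diff_diff_eq[symmetric] using assms
    by (intro generate.incl) blast
  moreover have "Poly_Mapping.keys (frag_of (x, y) + frag_of (x', y)) \<subseteq> carrier M \<times> carrier N"
    using assms keys_add[of "frag_of (x, y)" "frag_of (x', y)"] by auto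
  ultimately show ?thesis
    using hom_mult[OF tensor_projection_hom, of "frag_of (x, y)" "frag_of (x', y)"] assms
    unfolding pure_tensor_def by (simp add: tensor_coset_eqI)
qed

lemma pure_tensor_add_right:
  assumes "x \<in> carrier M" "y \<in> carrier N" "y' \<in> carrier N"
  shows "pure_tensor R M N x (y \<oplus>\<^bsub>N\<^esub> y')
    = pure_tensor R M N x y \<otimes>\<^bsub>tensor_group R M N\<^esub> pure_tensor R M N x y'"
proof -
  have "frag_of (x, y \<oplus>\<^bsub>N\<^esub> y') - (frag_of (x, y) + frag_of (x, y')) \<in> tensor_relations R M N"
    unfolding tensor_relations_def diff_diff_eq[symmetric] using assms
    by (intro generate.incl) blast
  moreover have "Poly_Mapping.keys (frag_of (x, y) + frag_of (x, y')) \<subseteq> carrier M \<times> carrier N"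
    using assms keys_add[of "frag_of (x, y)" "frag_of (x, y')"] by auto
  ultimately show ?thesis
    using hom_mult[OF tensor_projection_hom, of "frag_of (x, y)" "frag_of (x, y')"] assms
    unfolding pure_tensor_def by (simp add: tensor_coset_eqI)
qed

lemma pure_tensor_smult:
  assumes "a \<in> carrier R" "x \<in> carrier M" "y \<in> carrier N"
  shows "pure_tensor R M N (a \<odot>\<^bsub>M\<^esub> x) y = pure_tensor R M N x (a \<odot>\<^bsub>N\<^esub> y)"
  unfolding pure_tensor_def using assms
  by (intro tensor_coset_eqI) (auto simp: tensor_relations_def intro!: generate.incl)

text \<open>Pure tensors generate the tensor group. The complex, chain map and homotopy identities
  for \<open>Tor\<close> below are all checked on them.\<close>

lemma tensor_group_hom_eqI:
  assumes K: "group K" and h: "h \<in> hom (tensor_group R M N) K" and k: "k \<in> hom (tensor_group R M N) K"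
    and eq: "\<And>x y. x \<in> carrier M \<Longrightarrow> y \<in> carrier N \<Longrightarrow>
      h (pure_tensor R M N x y) = k (pure_tensor R M N x y)"
    and z: "z \<in> carrier (tensor_group R M N)"
  shows "h z = k z"
proof -
  let ?F = "free_Abelian_group (carrier M \<times> carrier N)"
  let ?p = "\<lambda>u. tensor_relations R M N #>\<^bsub>?F\<^esub> u"
  obtain u where u: "Poly_Mapping.keys u \<subseteq> carrier M \<times> carrier N" "z = ?p u"
    using z unfolding tensor_group_def carrier_FactGroup by auto
  interpret h: group_hom ?F K "h \<circ> ?p"
    using hom_compose[OF tensor_projection_hom h] K by (simp add: group_hom_def group_hom_axioms_def)
  interpret k: group_hom ?F K "k \<circ> ?p"
    using hom_compose[OF tensor_projection_hom k] K by (simp add: group_hom_def group_hom_axioms_def)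
  have "(h \<circ> ?p) u = (k \<circ> ?p) u"
  proof (rule free_Abelian_group_induct[OF u(1), where P = "\<lambda>u. (h \<circ> ?p) u = (k \<circ> ?p) u"])
    show "(h \<circ> ?p) 0 = (k \<circ> ?p) 0"
      using h.hom_one k.hom_one by simp
  next
    fix x y
    assume xy: "Poly_Mapping.keys x \<subseteq> carrier M \<times> carrier N" "Poly_Mapping.keys y \<subseteq> carrier M \<times> carrier N"
      and eq: "(h \<circ> ?p) x = (k \<circ> ?p) x" "(h \<circ> ?p) y = (k \<circ> ?p) y"
    \<comment> \<open>The induction principle steps through differences; written with the group
      operations, they become accessible to the homomorphism laws.\<close>
    have "x - y = x \<otimes>\<^bsub>?F\<^esub> inv\<^bsub>?F\<^esub> y"
      using xy by simp
    moreover have "x \<in> carrier ?F" "y \<in> carrier ?F"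
      using xy by simp_all
    ultimately show "(h \<circ> ?p) (x - y) = (k \<circ> ?p) (x - y)"
      by (simp only: h.hom_mult k.hom_mult h.hom_inv k.hom_inv F.inv_closed eq)
  next
    show "(h \<circ> ?p) (frag_of z) = (k \<circ> ?p) (frag_of z)" if "z \<in> carrier M \<times> carrier N" for z
      using that eq by (cases z) (auto simp: pure_tensor_def)
  qed
  then show ?thesis
    using u(2) by simp
qed

text \<open>The universal property: \<beta> extends to the free abelian group, which is where
  commutativity of K enters, and then factors through the relations.\<close>

lemma tensor_group_lift:
  assumes K: "comm_group K"
    and cl: "\<And>x y. x \<in> carrier M \<Longrightarrow> y \<in> carrier N \<Longrightarrow> \<beta> x y \<in> carrier K"
    and addl: "\<And>x x' y. x \<in> carrier M \<Longrightarrow> x' \<in> carrier M \<Longrightarrow> y \<in> carrier N \<Longrightarrow>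
        \<beta> (x \<oplus>\<^bsub>M\<^esub> x') y = \<beta> x y \<otimes>\<^bsub>K\<^esub> \<beta> x' y"
    and addr: "\<And>x y y'. x \<in> carrier M \<Longrightarrow> y \<in> carrier N \<Longrightarrow> y' \<in> carrier N \<Longrightarrow>
        \<beta> x (y \<oplus>\<^bsub>N\<^esub> y') = \<beta> x y \<otimes>\<^bsub>K\<^esub> \<beta> x y'"
    and bal: "\<And>a x y. a \<in> carrier R \<Longrightarrow> x \<in> carrier M \<Longrightarrow> y \<in> carrier N \<Longrightarrow>
        \<beta> (a \<odot>\<^bsub>M\<^esub> x) y = \<beta> x (a \<odot>\<^bsub>N\<^esub> y)"
  obtains h where "h \<in> hom (tensor_group R M N) K"
    and "\<And>x y. x \<in> carrier M \<Longrightarrow> y \<in> carrier N \<Longrightarrow> h (pure_tensor R M N x y) = \<beta> x y"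
proof -
  let ?F = "free_Abelian_group (carrier M \<times> carrier N)"
  interpret K: comm_group K by fact
  obtain h where h: "h \<in> hom ?F K"
    and h\<beta>: "\<And>z. z \<in> carrier M \<times> carrier N \<Longrightarrow> h (frag_of z) = case_prod \<beta> z"
    by (rule K.free_Abelian_group_universal[of "case_prod \<beta>" "carrier M \<times> carrier N"])
      (use cl in auto)
  interpret h: group_hom ?F K h
    using h by (simp add: group_hom_def group_hom_axioms_def K.is_group)
  have "tensor_relations R M N \<subseteq> kernel ?F K h"
    by (rule tensor_relations_least[OF M N K.is_group h]) (simp_all add: h\<beta> addl addr bal)
  from h.FactGroup_universal_kernel[OF tensor_relations_normal this] obtain g
    where g: "g \<in> hom (?F Mod tensor_relations R M N) K"
      "\<And>u. u \<in> carrier ?F \<Longrightarrow> g (tensor_relations R M N #>\<^bsub>?F\<^esub> u) = h u"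
    by metis
  show thesis
    by (rule that[of g]) (use g h\<beta> in \<open>auto simp: tensor_group_def pure_tensor_def\<close>)
qed

end

lemma frag_extend_hom:
  assumes "\<And>z. z \<in> S \<Longrightarrow> Poly_Mapping.keys (f z) \<subseteq> S'"
  shows "frag_extend f \<in> hom (free_Abelian_group S) (free_Abelian_group S')"
proof (rule homI)
  show "frag_extend f u \<in> carrier (free_Abelian_group S')" if "u \<in> carrier (free_Abelian_group S)" for u
    using that assms keys_frag_extend[of f u] by (fastforce simp: subset_iff)
qed (simp add: frag_extend_add)

text \<open>\<open>tensor_map\<close> is a union over representatives. All of them yield the same
  coset, because the map to the target vanishes on the relations; hence the union collapses to the
  value of the factor map.\<close>

lemma
  assumes M: "module R M" and M': "module R M'" and N: "module R N" and f: "f \<in> linear_maps R M M'"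
  shows tensor_map_hom: "tensor_map R M' N f \<in> hom (tensor_group R M N) (tensor_group R M' N)"
    and tensor_map_pure_tensor: "\<And>x y. x \<in> carrier M \<Longrightarrow> y \<in> carrier N \<Longrightarrow>
      tensor_map R M' N f (pure_tensor R M N x y) = pure_tensor R M' N (f x) y"
proof -
  let ?F = "free_Abelian_group (carrier M \<times> carrier N)"
  let ?F' = "free_Abelian_group (carrier M' \<times> carrier N)"
  let ?N = "tensor_relations R M N" and ?N' = "tensor_relations R M' N"
  let ?\<phi> = "frag_extend (\<lambda>(x, y). frag_of (f x, y))"
  let ?T' = "tensor_group R M' N"
  interpret F: group ?F by simp
  interpret T': comm_group ?T' by (rule tensor_group_comm_group[OF M' N])
  define h where "h u = ?N' #>\<^bsub>?F'\<^esub> ?\<phi> u" for u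
  have "?\<phi> \<in> hom ?F ?F'"
    by (rule frag_extend_hom) (auto simp: linear_maps_closed[OF f])
  from hom_compose[OF this tensor_projection_hom[OF M' N]] have h: "h \<in> hom ?F ?T'"
    by (simp add: h_def[abs_def] o_def)
  have h_frag: "h (frag_of (x, y)) = pure_tensor R M' N (f x) y" for x y
    by (simp add: h_def pure_tensor_def)
  interpret h: group_hom ?F ?T' h
    using h by (simp add: group_hom_def group_hom_axioms_def)
  have "?N \<subseteq> kernel ?F ?T' h"
    by (rule tensor_relations_least[OF M N T'.is_group h])
      (auto simp: h_frag linear_maps_add[OF f] linear_maps_smult[OF f] linear_maps_closed[OF f]
        pure_tensor_add_left[OF M' N] pure_tensor_add_right[OF M' N] pure_tensor_smult[OF M' N])
  from h.FactGroup_universal_kernel[OF tensor_relations_normal[OF M N] this] obtain g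
    where g: "g \<in> hom (?F Mod ?N) ?T'" and gh: "\<And>u. u \<in> carrier ?F \<Longrightarrow> g (?N #>\<^bsub>?F\<^esub> u) = h u"
    by metis
  have tm: "tensor_map R M' N f (?N #>\<^bsub>?F\<^esub> u) = g (?N #>\<^bsub>?F\<^esub> u)" if u: "u \<in> carrier ?F" for u
  proof -
    note sub = tensor_relations_subgroup[OF M N]
    have "h v = h u" if v: "v \<in> ?N #>\<^bsub>?F\<^esub> u" for v
      using gh[of v] gh[of u] u F.repr_independence[OF v u sub]
        subgroup.elemrcos_carrier[OF sub F.is_group u v] by metis
    moreover have "u \<in> ?N #>\<^bsub>?F\<^esub> u"
      using F.rcos_self[OF u sub] .
    ultimately have "(\<Union>v\<in>?N #>\<^bsub>?F\<^esub> u. h v) = h u"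
      by blast
    then show ?thesis
      using gh[OF u] by (simp add: tensor_map_def h_def)
  qed
  show "tensor_map R M' N f \<in> hom (tensor_group R M N) ?T'"
  proof -
    have eq: "tensor_map R M' N f z = g z" if "z \<in> carrier (?F Mod ?N)" for z
      using that tm unfolding carrier_FactGroup by auto
    interpret T: group "?F Mod ?N"
      by (rule normal.factorgroup_is_group[OF tensor_relations_normal[OF M N]])
    show ?thesis
      unfolding tensor_group_def[of R M N]
      by (rule homI; simp only: eq T.m_closed hom_mult[OF g] hom_in_carrier[OF g])
  qed
  show "tensor_map R M' N f (pure_tensor R M N x y) = pure_tensor R M' N (f x) y"
    if "x \<in> carrier M" "y \<in> carrier N" for x y
    using that tm[of "frag_of (x, y)"] gh[of "frag_of (x, y)"] h_frag
    by (simp add: pure_tensor_def[of R M N])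
qed

section \<open>Homology groups\<close>

text \<open>First isomorphism theorem for a map v on the cycles whose kernel consists of the
  boundaries. The nonzero \<open>Tor\<close> and \<open>Ext\<close> groups are both computed by
  exhibiting such a v.\<close>

lemma homology_at_iso:
  assumes g: "group_hom H L g" and Y: "group Y"
    and v: "v \<in> hom (H\<lparr>carrier := kernel H L g\<rparr>) Y" "v ` kernel H L g = carrier Y"
    and im: "f ` carrier G \<subseteq> kernel H L g"
    and ker: "\<And>z. z \<in> kernel H L g \<Longrightarrow> v z = \<one>\<^bsub>Y\<^esub> \<longleftrightarrow> z \<in> f ` carrier G"
  shows "homology_at G H L f g \<cong> Y"
proof -
  interpret g: group_hom H L g by fact
  let ?Z = "H\<lparr>carrier := kernel H L g\<rparr>"
  interpret v: group_hom ?Z Y v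
    using v(1) Y subgroup.subgroup_is_group[OF g.subgroup_kernel g.G.is_group]
    by (simp add: group_hom_def group_hom_axioms_def)
  have "kernel ?Z Y v = f ` carrier G"
    using im ker unfolding kernel_def[of ?Z] by auto
  moreover have "?Z Mod kernel ?Z Y v \<cong> Y"
    by (rule v.FactGroup_iso) (simp add: v(2))
  ultimately show ?thesis
    by (simp add: homology_at_def)
qed

lemma homology_at_trivial:
  assumes g: "group_hom H L g" and im: "f ` carrier G = kernel H L g"
  shows "trivial_group (homology_at G H L f g)"
proof -
  interpret g: group_hom H L g by fact
  let ?Z = "H\<lparr>carrier := kernel H L g\<rparr>"
  interpret Z: group ?Z
    using subgroup.subgroup_is_group[OF g.subgroup_kernel g.G.is_group] .
  interpret N: normal "carrier ?Z" ?Z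
    by (rule Z.normal_self)
  have "carrier (?Z Mod carrier ?Z) = {\<one>\<^bsub>?Z Mod carrier ?Z\<^esub>}"
    unfolding carrier_FactGroup one_FactGroup
    using Z.coset_join2[OF _ Z.subgroup_self] Z.one_closed by (intro equalityI subsetI; blast)
  then show ?thesis
    using N.factorgroup_is_group im by (simp add: homology_at_def trivial_group_def)
qed

section \<open>Quotient modules\<close>

lemma quotient_module_simps [simp]:
  "carrier (quotient_module R I) = carrier (R Quot I)"
  "\<zero>\<^bsub>quotient_module R I\<^esub> = \<zero>\<^bsub>R Quot I\<^esub>"
  "x \<oplus>\<^bsub>quotient_module R I\<^esub> y = x \<oplus>\<^bsub>R Quot I\<^esub> y"
  "a \<odot>\<^bsub>quotient_module R I\<^esub> x = (I +>\<^bsub>R\<^esub> a) \<otimes>\<^bsub>R Quot I\<^esub> x"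
  by (simp_all add: quotient_module_def)

text \<open>The regular and quotient modules are records rebuilt from the fields of a ring, so the
  group structure has to be carried over field by field.\<close>

lemma abelian_group_cong:
  assumes "abelian_group G" "carrier H = carrier G" "add H = add G" "\<zero>\<^bsub>H\<^esub> = \<zero>\<^bsub>G\<^esub>"
  shows "abelian_group H"
proof -
  interpret G: abelian_group G by fact
  show ?thesis
  proof (rule abelian_groupI)
    show "\<exists>y\<in>carrier H. y \<oplus>\<^bsub>H\<^esub> x = \<zero>\<^bsub>H\<^esub>" if "x \<in> carrier H" for x
      using that by (auto simp: assms(2-4) intro!: bexI[of _ "\<ominus>\<^bsub>G\<^esub> x"] G.l_neg)
  qed (auto simp: assms(2-4) G.a_ac)
qed

context cring
begin

lemma regular_module: "module R (regular_module R)"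
proof (rule moduleI)
  show "abelian_group (regular_module R)"
    by (rule abelian_group_cong[OF is_abelian_group]) (simp_all add: regular_module_def)
qed (auto simp: is_cring l_distr r_distr m_assoc)

lemma regular_module_free: "free_module R (regular_module R)"
proof -
  have "\<exists>!c. c \<in> UNIV \<rightarrow> carrier R \<and> finite {b. c b \<noteq> \<zero>} \<and> {b. c b \<noteq> \<zero>} \<subseteq> {\<one>}
      \<and> x = (\<Oplus>\<^bsub>regular_module R\<^esub>b\<in>{b. c b \<noteq> \<zero>}. c b \<odot>\<^bsub>regular_module R\<^esub> b)"
    if x: "x \<in> carrier R" for x
  proof -
    interpret M: module R "regular_module R" by (rule regular_module)
    have sum: "(\<Oplus>\<^bsub>regular_module R\<^esub>b\<in>{b. c b \<noteq> \<zero>}. c b \<odot>\<^bsub>regular_module R\<^esub> b) = c \<one>"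
      if c: "c \<in> UNIV \<rightarrow> carrier R" "{b. c b \<noteq> \<zero>} \<subseteq> {\<one>}" for c
    proof -
      have c1: "c \<one> \<in> carrier R"
        using c by auto
      show ?thesis
      \<comment> \<open>The sum ranges over the exact support, which is empty when the coefficient
        at \<one> vanishes.\<close>
      proof (cases "c \<one> = \<zero>")
        case True
        then have e: "{b. c b \<noteq> \<zero>} = {}"
          using c(2) by blast
        show ?thesis
          unfolding e using True by simp
      next
        case False
        then have e: "{b. c b \<noteq> \<zero>} = {\<one>}"
          using c(2) by blast
        show ?thesis
          unfolding e using c1 by (simp add: M.finsum_insert)
      qed
    qed
    show ?thesis
    proof (rule ex1I)
      let ?c = "\<lambda>b. if b = \<one> then x else \<zero>"
      have "{b. ?c b \<noteq> \<zero>} \<subseteq> {\<one>}" by auto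
      moreover from this have "finite {b. ?c b \<noteq> \<zero>}" by (rule finite_subset) simp
      moreover have "?c \<in> UNIV \<rightarrow> carrier R" using x by auto
      moreover from calculation have "(\<Oplus>\<^bsub>regular_module R\<^esub>b\<in>{b. ?c b \<noteq> \<zero>}. ?c b \<odot>\<^bsub>regular_module R\<^esub> b) = ?c \<one>"
        by (intro sum) blast+
      moreover have "?c \<one> = x" by simp
      ultimately show "?c \<in> UNIV \<rightarrow> carrier R \<and> finite {b. ?c b \<noteq> \<zero>} \<and> {b. ?c b \<noteq> \<zero>} \<subseteq> {\<one>}
          \<and> x = (\<Oplus>\<^bsub>regular_module R\<^esub>b\<in>{b. ?c b \<noteq> \<zero>}. ?c b \<odot>\<^bsub>regular_module R\<^esub> b)"
        by metis
    next
      fix c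
      assume c: "c \<in> UNIV \<rightarrow> carrier R \<and> finite {b. c b \<noteq> \<zero>} \<and> {b. c b \<noteq> \<zero>} \<subseteq> {\<one>}
          \<and> x = (\<Oplus>\<^bsub>regular_module R\<^esub>b\<in>{b. c b \<noteq> \<zero>}. c b \<odot>\<^bsub>regular_module R\<^esub> b)"
      then have "x = c \<one>"
        using sum[of c] by metis
      moreover have "c b = \<zero>" if "b \<noteq> \<one>" for b
        using c that by blast
      ultimately show "c = (\<lambda>b. if b = \<one> then x else \<zero>)"
        by force
    qed
  qed
  then have "is_basis R (regular_module R) {\<one>}"
    by (simp add: is_basis_def)
  then show ?thesis
    using regular_module by (auto simp: free_module_def)
qed

context
  fixes I assumes I: "ideal I R"
begin

interpretation I: ideal I R by (rule I)
interpretation Q: cring "R Quot I" by (rule I.quotient_is_cring[OF is_cring])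
interpretation pr: ring_hom_ring R "R Quot I" "(+>) I" by (rule I.rcos_ring_hom_ring)

lemma quotient_module_module: "module R (quotient_module R I)"
proof (rule moduleI)
  show "abelian_group (quotient_module R I)"
    by (rule abelian_group_cong[OF Q.is_abelian_group]) (simp_all add: quotient_module_def)
qed (auto simp: is_cring Q.l_distr Q.r_distr Q.m_assoc)

lemma quotient_module_projection_linear:
  "(+>) I \<in> linear_maps R (regular_module R) (quotient_module R I)"
  by (rule linear_mapsI) (simp_all add: pr.hom_closed pr.hom_add pr.hom_mult)

lemma quotient_module_projection_surj: "(+>) I ` carrier R = carrier (quotient_module R I)"
  unfolding quotient_module_simps FactRing_def A_RCOSETS_def' partial_object.simps by blast

lemma quotient_module_projection_eq_zero:
  "x \<in> carrier R \<Longrightarrow> I +> x = \<zero>\<^bsub>R Quot I\<^esub> \<longleftrightarrow> x \<in> I"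
  using a_coset_join1[of I x] a_coset_join2[of x I] I.a_subgroup I.a_rcos_self[of x]
  unfolding FactRing_def ring.simps monoid.simps by metis

end

end

section \<open>Two-periodic resolutions\<close>

text \<open>A pair of exact zero divisors: each generates the annihilator of the other. This is
  exactly what makes alternating multiplication by \<open>t\<close> and \<kappa> exact.\<close>

locale periodic_cring = cring R for R (structure) +
  fixes t \<kappa>
  assumes t_closed [simp]: "t \<in> carrier R" and kappa_closed [simp]: "\<kappa> \<in> carrier R"
    and annihilator_t: "\<And>x. x \<in> carrier R \<Longrightarrow> t \<otimes> x = \<zero> \<longleftrightarrow> x \<in> PIdl \<kappa>"
    and annihilator_kappa: "\<And>x. x \<in> carrier R \<Longrightarrow> \<kappa> \<otimes> x = \<zero> \<longleftrightarrow> x \<in> PIdl t"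
begin

text \<open>Multiplier of the differential from degree n+1 to degree n, hence \<kappa> at n =
  0.\<close>

definition \<theta> :: "nat \<Rightarrow> 'a" where "\<theta> n = (if even n then \<kappa> else t)"

abbreviation quotient :: "('a, 'a set) module" where "quotient \<equiv> quotient_module R (PIdl \<kappa>)"

lemma theta_closed [simp]: "\<theta> n \<in> carrier R"
  by (simp add: \<theta>_def)

text \<open>Both annihilator axioms in a form uniform in the parity, so that kernels and images can
  be compared without case distinctions.\<close>

lemma annihilator_theta:
  "x \<in> carrier R \<Longrightarrow> \<theta> n \<otimes> x = \<zero> \<longleftrightarrow> x \<in> (\<lambda>y. \<theta> (Suc n) \<otimes> y) ` carrier R"
  by (auto simp: \<theta>_def annihilator_t annihilator_kappa cgenideal_def image_iff m_comm)

lemma theta_theta: "\<theta> n \<otimes> \<theta> (Suc n) = \<zero>"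
  using annihilator_theta[of "\<theta> (Suc n)" n] by (metis theta_closed image_eqI one_closed r_one)

lemma kappa_ideal: "ideal (PIdl \<kappa>) R"
  by (rule cgenideal_ideal) simp

theorem periodic_free_resolution:
  "free_resolution R (\<lambda>_. regular_module R) (\<lambda>n x. \<theta> n \<otimes> x) ((+>) (PIdl \<kappa>)) quotient"
  unfolding free_resolution_def resolution_def
proof (intro conjI allI regular_module regular_module_free quotient_module_module
    quotient_module_projection_linear kappa_ideal)
  show "(\<lambda>x. \<theta> n \<otimes> x) \<in> linear_maps R (regular_module R) (regular_module R)" for n
    by (rule linear_mapsI) (auto simp: r_distr m_lcomm)
  show "(+>) (PIdl \<kappa>) ` carrier (regular_module R) = carrier quotient"
    using quotient_module_projection_surj[OF kappa_ideal] by simp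
  show "(\<lambda>x. \<theta> 0 \<otimes> x) ` carrier (regular_module R)
      = a_kernel (regular_module R) quotient ((+>) (PIdl \<kappa>))"
  proof -
    have "(\<lambda>x. \<theta> 0 \<otimes> x) ` carrier R = PIdl \<kappa>"
      by (auto simp: \<theta>_def cgenideal_def m_comm)
    moreover have "{x \<in> carrier R. PIdl \<kappa> +> x = \<zero>\<^bsub>R Quot PIdl \<kappa>\<^esub>} = PIdl \<kappa>"
      using quotient_module_projection_eq_zero[OF kappa_ideal] ideal.Icarr[OF kappa_ideal] by blast
    ultimately show ?thesis
      by (simp add: a_kernel_def')
  qed
  show "(\<lambda>x. \<theta> (Suc n) \<otimes> x) ` carrier (regular_module R)
      = a_kernel (regular_module R) (regular_module R) (\<lambda>x. \<theta> n \<otimes> x)" for n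
  proof -
    have "(\<lambda>x. \<theta> (Suc n) \<otimes> x) ` carrier R \<subseteq> carrier R" by auto
    then show ?thesis
      using annihilator_theta[of _ n] by (auto simp: a_kernel_def')
  qed
qed

text \<open>The condition on \<open>g n (p n)\<close> stands in for a homotopy on the periodic side.
  In degree 0 this element differs from 1 by a multiple of \<kappa>, since both have the same class
  in the quotient; passing from degree n to n+1 changes it by a multiple of
  \<open>\<theta> (Suc n)\<close>.\<close>

lemma comparison_with_periodic_resolution:
  fixes P :: "nat \<Rightarrow> ('a, 'p) module"
  assumes P: "projective_resolution R P \<delta> \<epsilon> quotient"
  obtains p g s where "\<And>n. p n \<in> carrier (P n)" "\<And>n. \<delta> n (p (Suc n)) = \<theta> n \<odot>\<^bsub>P n\<^esub> p n"
    and "\<And>n. g n \<in> linear_maps R (P n) (regular_module R)"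
    and "\<And>n x. x \<in> carrier (P (Suc n)) \<Longrightarrow> \<theta> n \<otimes> g (Suc n) x = g n (\<delta> n x)"
    and "\<And>n. \<exists>a\<in>carrier R. \<exists>b\<in>carrier R. g n (p n) = \<one> \<oplus> (\<kappa> \<otimes> a \<oplus> t \<otimes> b)"
    and "\<And>n. s n \<in> linear_maps R (P n) (P (Suc n))"
    and "\<And>n x. x \<in> carrier (P (Suc n)) \<Longrightarrow> x = (\<delta> (Suc n) (s (Suc n) x) \<oplus>\<^bsub>P (Suc n)\<^esub> s n (\<delta> n x))
      \<oplus>\<^bsub>P (Suc n)\<^esub> g (Suc n) x \<odot>\<^bsub>P (Suc n)\<^esub> p (Suc n)"
proof -
  let ?pr = "(+>) (PIdl \<kappa>)"
  have res: "resolution R P \<delta> \<epsilon> quotient" and proj: "projective_module R (P n)" for n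
    using P by (simp_all add: projective_resolution_def)
  note mP = resolution_module[OF res] and d = resolution_linear[OF res]
    and e = resolution_linear_augmentation[OF res]
  have Q: "resolution R (\<lambda>_. regular_module R) (\<lambda>n x. \<theta> n \<otimes> x) ?pr quotient"
    using periodic_free_resolution by (simp add: free_resolution_def)
  interpret Q: cring "R Quot PIdl \<kappa>"
    by (rule ideal.quotient_is_cring[OF kappa_ideal is_cring])
  interpret pr: ring_hom_ring R "R Quot PIdl \<kappa>" ?pr
    by (rule ideal.rcos_ring_hom_ring[OF kappa_ideal])
  have pr_kappa: "?pr \<kappa> = \<zero>\<^bsub>R Quot PIdl \<kappa>\<^esub>"
    using quotient_module_projection_eq_zero[OF kappa_ideal] cgenideal_self by simp
  obtain g where g: "\<And>n. g n \<in> linear_maps R (P n) (regular_module R)"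
    and g0: "\<And>x. x \<in> carrier (P 0) \<Longrightarrow> ?pr (g 0 x) = \<epsilon> x"
    and gS: "\<And>n x. x \<in> carrier (P (Suc n)) \<Longrightarrow> \<theta> n \<otimes> g (Suc n) x = g n (\<delta> n x)"
    by (rule resolution_lift_identity[OF res proj Q]) blast
  have gR: "g n x \<in> carrier R" if "x \<in> carrier (P n)" for n x
    using linear_maps_closed[OF g that] by simp
  \<comment> \<open>A chain map out of free modules of rank one is a choice of elements; the middle
    clause of \<open>J\<close> makes the choice in the next degree possible.\<close>
  define J where "J n x \<longleftrightarrow> x \<in> carrier (P n) \<and> \<theta> n \<odot>\<^bsub>P n\<^esub> x \<in> \<delta> n ` carrier (P (Suc n))
    \<and> (n = 0 \<longrightarrow> \<epsilon> x = ?pr \<one>)" for n x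
  obtain p0 where p0: "p0 \<in> carrier (P 0)" "\<epsilon> p0 = ?pr \<one>"
    using resolution_surj[OF res] pr.hom_closed[OF one_closed]
    by (metis (no_types, lifting) image_iff quotient_module_simps(1))
  have "J 0 p0"
  proof -
    interpret P0: module R "P 0" by (rule mP)
    have "\<epsilon> (\<theta> 0 \<odot>\<^bsub>P 0\<^esub> p0) = \<zero>\<^bsub>quotient\<^esub>"
      using p0 by (simp add: linear_maps_smult[OF e] \<theta>_def pr_kappa)
    then have "\<theta> 0 \<odot>\<^bsub>P 0\<^esub> p0 \<in> \<delta> 0 ` carrier (P (Suc 0))"
      using p0 by (intro resolution_exact_0[OF res]) auto
    then show ?thesis
      using p0 by (simp add: J_def)
  qed
  moreover have "\<exists>y. J (Suc n) y \<and> \<delta> n y = \<theta> n \<odot>\<^bsub>P n\<^esub> x" if x: "J n x" for n x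
  proof -
    interpret Pn: module R "P n" by (rule mP)
    interpret PS: module R "P (Suc n)" by (rule mP)
    obtain y where y: "y \<in> carrier (P (Suc n))" "\<delta> n y = \<theta> n \<odot>\<^bsub>P n\<^esub> x"
      using x unfolding J_def by force
    \<comment> \<open>Consecutive multipliers have product zero, so this element is a cycle and
      exactness restores \<open>J\<close>.\<close>
    have "\<delta> n (\<theta> (Suc n) \<odot>\<^bsub>P (Suc n)\<^esub> y) = (\<theta> n \<otimes> \<theta> (Suc n)) \<odot>\<^bsub>P n\<^esub> x"
      using x y by (simp add: J_def linear_maps_smult[OF d] Pn.smult_assoc1 m_comm flip: Pn.smult_assoc1)
    then have "\<theta> (Suc n) \<odot>\<^bsub>P (Suc n)\<^esub> y \<in> \<delta> (Suc n) ` carrier (P (Suc (Suc n)))"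
      using x y by (intro resolution_exact[OF res]) (auto simp: theta_theta J_def)
    with y show ?thesis
      by (auto simp: J_def)
  qed
  ultimately obtain p where p: "\<And>n. J n (p n)" "\<And>n. \<delta> n (p (Suc n)) = \<theta> n \<odot>\<^bsub>P n\<^esub> p n"
    using dependent_nat_choice[of J "\<lambda>n x y. \<delta> n y = \<theta> n \<odot>\<^bsub>P n\<^esub> x"] by metis
  have pP: "p n \<in> carrier (P n)" for n
    using p(1) by (simp add: J_def)
  have gp: "\<exists>a\<in>carrier R. \<exists>b\<in>carrier R. g n (p n) = \<one> \<oplus> (\<kappa> \<otimes> a \<oplus> t \<otimes> b)" for n
  proof (induction n)
    case 0
    have "?pr (g 0 (p 0) \<ominus> \<one>) = \<zero>\<^bsub>R Quot PIdl \<kappa>\<^esub>"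
      using g0[OF pP] p(1)[of 0] gR[OF pP] by (simp add: J_def a_minus_def Q.r_neg)
    then have "g 0 (p 0) \<ominus> \<one> \<in> PIdl \<kappa>"
      using quotient_module_projection_eq_zero[OF kappa_ideal] gR[OF pP] by simp
    then obtain a where a: "a \<in> carrier R" "g 0 (p 0) \<ominus> \<one> = \<kappa> \<otimes> a"
      by (auto simp: cgenideal_def m_comm)
    have "g 0 (p 0) = \<one> \<oplus> (g 0 (p 0) \<ominus> \<one>)"
      using gR[OF pP, of 0] by algebra
    then show ?case
      using a by (intro bexI[of _ a] bexI[of _ \<zero>]) auto
  next
    case (Suc n)
    obtain a b where ab: "a \<in> carrier R" "b \<in> carrier R" "g n (p n) = \<one> \<oplus> (\<kappa> \<otimes> a \<oplus> t \<otimes> b)"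
      using Suc by blast
    have c: "g n (p n) \<in> carrier R" "g (Suc n) (p (Suc n)) \<in> carrier R"
      using gR[OF pP] by auto
    \<comment> \<open>The chain map equations of \<open>g\<close> and \<open>p\<close> combine to
      this equality. The difference of the two elements is thus annihilated by
      \<open>\<theta> n\<close>, so it is a multiple of \<open>\<theta> (Suc n)\<close>.\<close>
    have "\<theta> n \<otimes> g (Suc n) (p (Suc n)) = \<theta> n \<otimes> g n (p n)"
      using gS[OF pP] p(2) linear_maps_smult[OF g _ pP] by simp
    moreover have "\<theta> n \<otimes> (g (Suc n) (p (Suc n)) \<ominus> g n (p n))
        = \<theta> n \<otimes> g (Suc n) (p (Suc n)) \<ominus> \<theta> n \<otimes> g n (p n)"
      using c by (simp add: a_minus_def r_distr r_minus)
    ultimately have "\<theta> n \<otimes> (g (Suc n) (p (Suc n)) \<ominus> g n (p n)) = \<zero>"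
      using c by (simp add: a_minus_def r_neg)
    then obtain y where y: "y \<in> carrier R" "g (Suc n) (p (Suc n)) \<ominus> g n (p n) = \<theta> (Suc n) \<otimes> y"
      using annihilator_theta c by (metis (no_types, lifting) imageE minus_closed)
    have eq: "g (Suc n) (p (Suc n)) = g n (p n) \<oplus> \<theta> (Suc n) \<otimes> y"
      unfolding y(2)[symmetric] using c by algebra
    show ?case
    \<comment> \<open>\<open>y\<close> is absorbed into the coefficient of \<kappa> or of
      \<open>t\<close>, whichever \<open>\<theta> (Suc n)\<close> is.\<close>
    proof (cases "even (Suc n)")
      case True
      then have "g (Suc n) (p (Suc n)) = \<one> \<oplus> (\<kappa> \<otimes> (a \<oplus> y) \<oplus> t \<otimes> b)"
        unfolding eq ab(3) \<theta>_def using ab(1,2) y(1) kappa_closed t_closed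
        by (simp add: r_distr a_ac)
      then show ?thesis using ab(1,2) y(1) by blast
    next
      case False
      then have "g (Suc n) (p (Suc n)) = \<one> \<oplus> (\<kappa> \<otimes> a \<oplus> t \<otimes> (b \<oplus> y))"
        unfolding eq ab(3) \<theta>_def using ab(1,2) y(1) kappa_closed t_closed
        by (simp add: r_distr a_ac)
      then show ?thesis using ab(1,2) y(1) by blast
    qed
  qed
  \<comment> \<open>Identity minus the round trip through the periodic resolution. Both lift the
    identity of the quotient, so \<open>h\<close> lies over zero.\<close>
  define h where "h n x = x \<ominus>\<^bsub>P n\<^esub> g n x \<odot>\<^bsub>P n\<^esub> p n" for n x
  have h: "h n \<in> linear_maps R (P n) (P n)" for n
    unfolding h_def
    by (rule linear_maps_diff[OF mP _ linear_maps_smult_const[OF mP g pP]]) (simp add: linear_maps_def)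
  have h0: "\<epsilon> (h 0 x) = \<zero>\<^bsub>quotient\<^esub>" if x: "x \<in> carrier (P 0)" for x
  proof -
    interpret P0: module R "P 0" by (rule mP)
    interpret QM: module R quotient by (rule quotient_module_module[OF kappa_ideal])
    have "\<epsilon> (h 0 x) = \<epsilon> x \<ominus>\<^bsub>quotient\<^esub> \<epsilon> (g 0 x \<odot>\<^bsub>P 0\<^esub> p 0)"
      unfolding h_def using x gR pP
      by (intro linear_maps_minus[OF mP quotient_module_module[OF kappa_ideal] e]) auto
    also have "\<epsilon> (g 0 x \<odot>\<^bsub>P 0\<^esub> p 0) = \<epsilon> x"
      using linear_maps_smult[OF e gR[OF x] pP] p(1)[of 0] g0[OF x] gR[OF x]
        linear_maps_closed[OF e x]
      by (simp add: J_def)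
    finally show ?thesis
      using linear_maps_closed[OF e x] by (simp only: QM.r_neg a_minus_def)
  qed
  have hS: "\<delta> n (h (Suc n) x) = h n (\<delta> n x)" if x: "x \<in> carrier (P (Suc n))" for n x
  proof -
    interpret Pn: module R "P n" by (rule mP)
    interpret PS: module R "P (Suc n)" by (rule mP)
    have "\<delta> n (g (Suc n) x \<odot>\<^bsub>P (Suc n)\<^esub> p (Suc n)) = g (Suc n) x \<odot>\<^bsub>P n\<^esub> (\<theta> n \<odot>\<^bsub>P n\<^esub> p n)"
      using linear_maps_smult[OF d gR[OF x] pP] p(2) by simp
    also have "\<dots> = g n (\<delta> n x) \<odot>\<^bsub>P n\<^esub> p n"
      using gR[OF x] pP by (simp add: m_comm gS[OF x, symmetric] flip: Pn.smult_assoc1)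
    finally show ?thesis
      unfolding h_def using x gR[OF x] pP by (simp add: linear_maps_minus[OF mP mP d])
  qed
  obtain s where s: "\<And>n. s n \<in> linear_maps R (P n) (P (Suc n))"
    and hs: "\<And>n x. x \<in> carrier (P (Suc n)) \<Longrightarrow>
           h (Suc n) x = \<delta> (Suc n) (s (Suc n) x) \<oplus>\<^bsub>P (Suc n)\<^esub> s n (\<delta> n x)"
    by (rule resolution_null_homotopic[OF res proj res h h0 hS]) blast+
  show thesis
  proof (rule that[OF pP p(2) g gS gp s])
    fix n x assume x: "x \<in> carrier (P (Suc n))"
    interpret PS: module R "P (Suc n)" by (rule mP)
    have "x = h (Suc n) x \<oplus>\<^bsub>P (Suc n)\<^esub> g (Suc n) x \<odot>\<^bsub>P (Suc n)\<^esub> p (Suc n)"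
      unfolding h_def using x gR[OF x] pP by (simp add: PS.minus_eq PS.a_assoc PS.l_neg)
    then show "x = (\<delta> (Suc n) (s (Suc n) x) \<oplus>\<^bsub>P (Suc n)\<^esub> s n (\<delta> n x))
        \<oplus>\<^bsub>P (Suc n)\<^esub> g (Suc n) x \<odot>\<^bsub>P (Suc n)\<^esub> p (Suc n)"
      by (simp only: hs[OF x])
  qed
qed

end

section \<open>Groups of linear maps\<close>

lemma Hom_group_simps:
  "carrier (Hom_group R M N) = linear_maps R M N \<inter> extensional (carrier M)"
  "f \<otimes>\<^bsub>Hom_group R M N\<^esub> g = (\<lambda>x\<in>carrier M. f x \<oplus>\<^bsub>N\<^esub> g x)"
  "\<one>\<^bsub>Hom_group R M N\<^esub> = (\<lambda>x\<in>carrier M. \<zero>\<^bsub>N\<^esub>)"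
  by (simp_all add: Hom_group_def)

text \<open>Members of \<open>Hom_group\<close> are extensional, so formulas enter it by restriction
  to the carrier; linearity survives because the carrier is closed under the operations.\<close>

lemma Hom_groupI:
  assumes "module R M" "f \<in> linear_maps R M N"
  shows "(\<lambda>x\<in>carrier M. f x) \<in> carrier (Hom_group R M N)"
proof -
  interpret M: module R M by fact
  show ?thesis
    using assms(2) by (auto simp: Hom_group_simps linear_maps_def)
qed

lemma linear_maps_add_fun:
  assumes "module R N" "f \<in> linear_maps R M N" "g \<in> linear_maps R M N"
  shows "(\<lambda>x. f x \<oplus>\<^bsub>N\<^esub> g x) \<in> linear_maps R M N"
proof -
  interpret N: module R N by fact
  show ?thesis
    using assms(2,3) by (intro linear_mapsI)
      (auto simp: linear_maps_closed linear_maps_add linear_maps_smult N.smult_r_distr N.a_ac)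
qed

lemma Hom_group_group:
  assumes M: "module R M" and N: "module R N"
  shows "group (Hom_group R M N)"
proof -
  interpret M: module R M by fact
  interpret N: module R N by fact
  have cl: "f x \<in> carrier N" if "f \<in> carrier (Hom_group R M N)" "x \<in> carrier M" for f x
    using that by (auto simp: Hom_group_simps intro: linear_maps_closed)
  show ?thesis
  proof (rule groupI)
    fix f g h
    assume f: "f \<in> carrier (Hom_group R M N)" and g: "g \<in> carrier (Hom_group R M N)"
    show "f \<otimes>\<^bsub>Hom_group R M N\<^esub> g \<in> carrier (Hom_group R M N)"
      using f g unfolding Hom_group_simps(2)
      by (intro Hom_groupI[OF M] linear_maps_add_fun[OF N]) (auto simp: Hom_group_simps(1))
    assume h: "h \<in> carrier (Hom_group R M N)"
    show "f \<otimes>\<^bsub>Hom_group R M N\<^esub> g \<otimes>\<^bsub>Hom_group R M N\<^esub> h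
        = f \<otimes>\<^bsub>Hom_group R M N\<^esub> (g \<otimes>\<^bsub>Hom_group R M N\<^esub> h)"
      using cl[OF f] cl[OF g] cl[OF h] by (auto simp: Hom_group_simps N.a_assoc)
  next
    show "\<one>\<^bsub>Hom_group R M N\<^esub> \<in> carrier (Hom_group R M N)"
      unfolding Hom_group_simps(3)
      by (intro Hom_groupI[OF M] linear_mapsI) auto
  next
    fix f assume f: "f \<in> carrier (Hom_group R M N)"
    show "\<one>\<^bsub>Hom_group R M N\<^esub> \<otimes>\<^bsub>Hom_group R M N\<^esub> f = f"
      using cl[OF f] f by (intro extensionalityI[of _ "carrier M"]) (auto simp: Hom_group_simps)
    have "(\<lambda>x. \<zero>\<^bsub>N\<^esub>) \<in> linear_maps R M N" "f \<in> linear_maps R M N"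
      using f by (auto simp: Hom_group_simps intro: linear_mapsI)
    then have "(\<lambda>x\<in>carrier M. \<zero>\<^bsub>N\<^esub> \<ominus>\<^bsub>N\<^esub> f x) \<in> carrier (Hom_group R M N)"
      by (intro Hom_groupI[OF M] linear_maps_diff[OF N])
    moreover have "(\<lambda>x\<in>carrier M. \<zero>\<^bsub>N\<^esub> \<ominus>\<^bsub>N\<^esub> f x) \<otimes>\<^bsub>Hom_group R M N\<^esub> f = \<one>\<^bsub>Hom_group R M N\<^esub>"
      using cl[OF f] by (auto simp: Hom_group_simps N.minus_eq N.l_neg)
    ultimately show "\<exists>g\<in>carrier (Hom_group R M N). g \<otimes>\<^bsub>Hom_group R M N\<^esub> f = \<one>\<^bsub>Hom_group R M N\<^esub>"
      by blast
  qed
qed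

lemma Hom_group_hom_compose:
  assumes M: "module R M" and L: "module R L" and N: "module R N" and f: "f \<in> linear_maps R L M"
  shows "group_hom (Hom_group R M N) (Hom_group R L N) (\<lambda>\<phi>. compose (carrier L) \<phi> f)"
proof -
  interpret M: module R M by fact
  interpret L: module R L by fact
  have "(\<lambda>\<phi>. compose (carrier L) \<phi> f) \<in> hom (Hom_group R M N) (Hom_group R L N)"
  proof (rule homI)
    fix \<phi> assume "\<phi> \<in> carrier (Hom_group R M N)"
    then show "compose (carrier L) \<phi> f \<in> carrier (Hom_group R L N)"
      unfolding compose_def
      by (intro Hom_groupI[OF L] linear_maps_comp[OF f]) (simp add: Hom_group_simps)
  qed (auto simp: Hom_group_simps compose_def linear_maps_closed[OF f])
  then show ?thesis
    by (simp add: group_hom_def group_hom_axioms_def Hom_group_group M L N)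
qed

section \<open>Tor and Ext over a two-periodic ring\<close>

text \<open>\<open>q\<close> presents \<open>Y\<close> as N/tN. With \<kappa> acting as zero, the
  complex on N has maps alternately 0 and \<open>t\<close>; its homology is N/tN or the kernel of
  \<open>t\<close>, and the last axiom makes the latter zero.\<close>

locale periodic_coefficients = periodic_cring +
  fixes N :: "('a, 'c) module" and q :: "'c \<Rightarrow> 'y" and Y :: "'y monoid"
  assumes N: "module R N" and Y: "group Y" and q: "q \<in> hom (add_monoid N) Y"
    and q_surj: "q ` carrier N = carrier Y"
    and q_kernel: "\<And>r. r \<in> carrier N \<Longrightarrow> q r = \<one>\<^bsub>Y\<^esub> \<longleftrightarrow> r \<in> (\<lambda>r. t \<odot>\<^bsub>N\<^esub> r) ` carrier N"
    and kappa_smult: "\<And>r. r \<in> carrier N \<Longrightarrow> \<kappa> \<odot>\<^bsub>N\<^esub> r = \<zero>\<^bsub>N\<^esub>"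
    and t_smult_inj: "\<And>r. r \<in> carrier N \<Longrightarrow> t \<odot>\<^bsub>N\<^esub> r = \<zero>\<^bsub>N\<^esub> \<Longrightarrow> r = \<zero>\<^bsub>N\<^esub>"

text \<open>The comparison data become fixed parameters, so that \<open>Tor\<close> and
  \<open>Ext\<close> are computed from the same \<open>p\<close>, \<open>g\<close> and
  \<open>s\<close>.\<close>

locale periodic_comparison = periodic_coefficients +
  fixes P :: "nat \<Rightarrow> ('a, 'p) module" and \<delta> \<epsilon> p g s
  assumes res: "resolution R P \<delta> \<epsilon> quotient"
    and p: "\<And>n. p n \<in> carrier (P n)" and \<delta>_p: "\<And>n. \<delta> n (p (Suc n)) = \<theta> n \<odot>\<^bsub>P n\<^esub> p n"
    and g: "\<And>n. g n \<in> linear_maps R (P n) (regular_module R)"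
    and g_\<delta>: "\<And>n x. x \<in> carrier (P (Suc n)) \<Longrightarrow> \<theta> n \<otimes> g (Suc n) x = g n (\<delta> n x)"
    and g_p: "\<And>n. \<exists>a\<in>carrier R. \<exists>b\<in>carrier R. g n (p n) = \<one> \<oplus> (\<kappa> \<otimes> a \<oplus> t \<otimes> b)"
    and s: "\<And>n. s n \<in> linear_maps R (P n) (P (Suc n))"
    and homotopy: "\<And>n x. x \<in> carrier (P (Suc n)) \<Longrightarrow>
      x = (\<delta> (Suc n) (s (Suc n) x) \<oplus>\<^bsub>P (Suc n)\<^esub> s n (\<delta> n x))
        \<oplus>\<^bsub>P (Suc n)\<^esub> g (Suc n) x \<odot>\<^bsub>P (Suc n)\<^esub> p (Suc n)"
begin

sublocale N: module R N by (rule N)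

lemmas P = resolution_module[OF res] and \<delta> = resolution_linear[OF res]

lemmas \<delta>_closed [simp] = linear_maps_closed[OF \<delta>] and s_closed [simp] = linear_maps_closed[OF s]

declare p [simp]

lemma g_closed [simp]: "x \<in> carrier (P n) \<Longrightarrow> g n x \<in> carrier R"
  using linear_maps_closed[OF g] by simp

lemma q_zero: "q \<zero>\<^bsub>N\<^esub> = \<one>\<^bsub>Y\<^esub>"
  using q_kernel[of "\<zero>\<^bsub>N\<^esub>"] by (metis N.zero_closed N.smult_r_null image_eqI t_closed)

lemma q_add: "r \<in> carrier N \<Longrightarrow> r' \<in> carrier N \<Longrightarrow> q (r \<oplus>\<^bsub>N\<^esub> r') = q r \<otimes>\<^bsub>Y\<^esub> q r'"
  using hom_mult[OF q, of r r'] by simp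

lemma q_closed [simp]: "r \<in> carrier N \<Longrightarrow> q r \<in> carrier Y"
  using q_surj by blast

text \<open>Of the correction to 1, the \<kappa>-part acts as zero on N and the t-part lands in tN,
  the kernel of \<open>q\<close>. This turns the congruence for \<open>g n (p n)\<close> into an
  equality after \<open>q\<close>.\<close>

lemma q_g_p:
  assumes r: "r \<in> carrier N"
  shows "q (g n (p n) \<odot>\<^bsub>N\<^esub> r) = q r"
proof -
  interpret Y: group Y by (rule Y)
  obtain a b where ab: "a \<in> carrier R" "b \<in> carrier R" "g n (p n) = \<one> \<oplus> (\<kappa> \<otimes> a \<oplus> t \<otimes> b)"
    using g_p by blast
  have "g n (p n) \<odot>\<^bsub>N\<^esub> r = r \<oplus>\<^bsub>N\<^esub> t \<odot>\<^bsub>N\<^esub> (b \<odot>\<^bsub>N\<^esub> r)"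
    unfolding ab(3) using ab(1,2) r by (simp add: N.smult_l_distr N.smult_assoc1 kappa_smult)
  moreover have "q (t \<odot>\<^bsub>N\<^esub> (b \<odot>\<^bsub>N\<^esub> r)) = \<one>\<^bsub>Y\<^esub>"
    using ab r q_kernel by auto
  ultimately show ?thesis
    using ab r by (simp add: q_add)
qed

subsection \<open>Tor\<close>

abbreviation "T n \<equiv> tensor_group R (P n) N"
abbreviation "D n \<equiv> tensor_map R (P n) N (\<delta> n)"
abbreviation "S n \<equiv> tensor_map R (P (Suc n)) N (s n)"
abbreviation "pure n \<equiv> pure_tensor R (P n) N"

lemma T_comm_group: "comm_group (T n)"
  by (rule tensor_group_comm_group[OF P N])

lemma T_group: "group (T n)"
  using T_comm_group by (rule comm_group.axioms)

lemma D_hom: "D n \<in> hom (T (Suc n)) (T n)"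
  by (rule tensor_map_hom[OF P P N \<delta>])

lemma D_pure: "x \<in> carrier (P (Suc n)) \<Longrightarrow> r \<in> carrier N \<Longrightarrow> D n (pure (Suc n) x r) = pure n (\<delta> n x) r"
  by (rule tensor_map_pure_tensor[OF P P N \<delta>])

lemma S_hom: "S n \<in> hom (T n) (T (Suc n))"
  by (rule tensor_map_hom[OF P P N s])

lemma S_pure: "x \<in> carrier (P n) \<Longrightarrow> r \<in> carrier N \<Longrightarrow> S n (pure n x r) = pure (Suc n) (s n x) r"
  by (rule tensor_map_pure_tensor[OF P P N s])

lemma pure_zero_right: "x \<in> carrier (P n) \<Longrightarrow> pure n x \<zero>\<^bsub>N\<^esub> = \<one>\<^bsub>T n\<^esub>"
proof -
  assume x: "x \<in> carrier (P n)"
  interpret T: group "T n" by (rule T_group)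
  have "pure n x \<zero>\<^bsub>N\<^esub> \<otimes>\<^bsub>T n\<^esub> pure n x \<zero>\<^bsub>N\<^esub> = pure n x \<zero>\<^bsub>N\<^esub>"
    using pure_tensor_add_right[OF P N x N.zero_closed N.zero_closed] by simp
  then show ?thesis
    using T.l_cancel_one pure_tensor_closed[OF P N x N.zero_closed] by metis
qed

lemma pure_zero_left: "r \<in> carrier N \<Longrightarrow> pure n \<zero>\<^bsub>P n\<^esub> r = \<one>\<^bsub>T n\<^esub>"
proof -
  assume r: "r \<in> carrier N"
  interpret Pn: module R "P n" by (rule P)
  have "pure n \<zero>\<^bsub>P n\<^esub> r = pure n (\<zero> \<odot>\<^bsub>P n\<^esub> \<zero>\<^bsub>P n\<^esub>) r"
    by simp
  also have "\<dots> = pure n \<zero>\<^bsub>P n\<^esub> \<zero>\<^bsub>N\<^esub>"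
    using r by (simp add: pure_tensor_smult[OF P N] del: Pn.smult_l_null Pn.smult_r_null)
  finally show ?thesis
    by (simp add: pure_zero_right)
qed

lemma pure_p_hom: "pure n (p n) \<in> hom (add_monoid N) (T n)"
  by (rule homI) (auto simp: pure_tensor_closed[OF P N] pure_tensor_add_right[OF P N])

lemma D_pure_p:
  "r \<in> carrier N \<Longrightarrow> D n (pure (Suc n) (p (Suc n)) r) = pure n (p n) (\<theta> n \<odot>\<^bsub>N\<^esub> r)"
  by (simp add: D_pure \<delta>_p pure_tensor_smult[OF P N])

lemma D_D:
  assumes "z \<in> carrier (T (Suc (Suc n)))"
  shows "D n (D (Suc n) z) = \<one>\<^bsub>T n\<^esub>"
proof -
  interpret T: group "T n" by (rule T_group)
  have "(\<lambda>z. \<one>\<^bsub>T n\<^esub>) \<in> hom (T (Suc (Suc n))) (T n)"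
    by (rule homI) auto
  then have "(D n \<circ> D (Suc n)) z = \<one>\<^bsub>T n\<^esub>"
    by (rule tensor_group_hom_eqI[OF P N T_group hom_compose[OF D_hom D_hom] _ _ assms])
      (simp add: D_pure resolution_complex[OF res] pure_zero_left)
  then show ?thesis
    by simp
qed

text \<open>The map \<open>g n\<close> tensored with N, followed by the identification of R
  \<otimes> N with N. The universal property only yields existence, hence the choice
  operator.\<close>

definition G :: "nat \<Rightarrow> ('p \<times> 'c \<Rightarrow>\<^sub>0 int) set \<Rightarrow> 'c" where
  "G n = (SOME h. h \<in> hom (T n) (add_monoid N) \<and>
     (\<forall>x\<in>carrier (P n). \<forall>r\<in>carrier N. h (pure n x r) = g n x \<odot>\<^bsub>N\<^esub> r))"

lemma G_exists:
  "\<exists>h. h \<in> hom (T n) (add_monoid N) \<and>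
     (\<forall>x\<in>carrier (P n). \<forall>r\<in>carrier N. h (pure n x r) = g n x \<odot>\<^bsub>N\<^esub> r)"
proof -
  have "g n (a \<odot>\<^bsub>P n\<^esub> x) \<odot>\<^bsub>N\<^esub> r = g n x \<odot>\<^bsub>N\<^esub> (a \<odot>\<^bsub>N\<^esub> r)"
    if "a \<in> carrier R" "x \<in> carrier (P n)" "r \<in> carrier N" for a x r
    using that by (simp add: linear_maps_smult[OF g] m_comm flip: N.smult_assoc1)
  then obtain h where "h \<in> hom (T n) (add_monoid N)"
    "\<And>x r. x \<in> carrier (P n) \<Longrightarrow> r \<in> carrier N \<Longrightarrow> h (pure n x r) = g n x \<odot>\<^bsub>N\<^esub> r"
    by (elim tensor_group_lift[OF P N N.a_comm_group, where \<beta> = "\<lambda>x r. g n x \<odot>\<^bsub>N\<^esub> r", rotated -1])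
      (simp_all add: linear_maps_add[OF g] N.smult_l_distr N.smult_r_distr)
  then show ?thesis
    by blast
qed

lemma G_hom: "G n \<in> hom (T n) (add_monoid N)"
  and G_pure: "x \<in> carrier (P n) \<Longrightarrow> r \<in> carrier N \<Longrightarrow> G n (pure n x r) = g n x \<odot>\<^bsub>N\<^esub> r"
  using someI_ex[OF G_exists[of n]] unfolding G_def[symmetric] by auto

lemma G_closed [simp]: "z \<in> carrier (T n) \<Longrightarrow> G n z \<in> carrier N"
  using hom_in_carrier[OF G_hom] by simp

text \<open>On pure tensors this is \<open>g_\<delta>\<close>. It makes \<open>G\<close> a chain map
  to the complex on N with multipliers \<open>\<theta> n\<close>.\<close>

lemma G_D:
  assumes "z \<in> carrier (T (Suc n))"
  shows "G n (D n z) = \<theta> n \<odot>\<^bsub>N\<^esub> G (Suc n) z"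
proof -
  have th: "(\<lambda>r. \<theta> n \<odot>\<^bsub>N\<^esub> r) \<in> hom (add_monoid N) (add_monoid N)"
    by (rule homI) (auto simp: N.smult_r_distr)
  have "(G n \<circ> D n) z = ((\<lambda>r. \<theta> n \<odot>\<^bsub>N\<^esub> r) \<circ> G (Suc n)) z"
    by (rule tensor_group_hom_eqI[OF P N N.a_group hom_compose[OF D_hom G_hom]
          hom_compose[OF G_hom th] _ assms])
      (simp add: D_pure G_pure g_\<delta>[symmetric] N.smult_assoc1)
  then show ?thesis by simp
qed

text \<open>On pure tensors this is the homotopy on \<open>P\<close>. Balancing moves the scalar
  \<open>g (Suc n) x\<close> to the other factor, so the round trip becomes \<open>p (Suc n)\<close>
  tensored with a value of \<open>G\<close>.\<close>

lemma T_homotopy: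
  assumes z: "z \<in> carrier (T (Suc n))"
  shows "z = (D (Suc n) (S (Suc n) z) \<otimes>\<^bsub>T (Suc n)\<^esub> S n (D n z))
    \<otimes>\<^bsub>T (Suc n)\<^esub> pure (Suc n) (p (Suc n)) (G (Suc n) z)"
proof -
  interpret T: comm_group "T (Suc n)" by (rule T_comm_group)
  interpret PS: module R "P (Suc n)" by (rule P)
  let ?h = "\<lambda>z. ((D (Suc n) \<circ> S (Suc n)) z \<otimes>\<^bsub>T (Suc n)\<^esub> (S n \<circ> D n) z)
    \<otimes>\<^bsub>T (Suc n)\<^esub> (pure (Suc n) (p (Suc n)) \<circ> G (Suc n)) z"
  have h: "?h \<in> hom (T (Suc n)) (T (Suc n))"
    by (intro T.hom_group_mult hom_compose[OF S_hom D_hom] hom_compose[OF D_hom S_hom]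
        hom_compose[OF G_hom pure_p_hom])
  have "(\<lambda>z. z) z = ?h z"
  proof (rule tensor_group_hom_eqI[OF P N T_group _ h _ z])
    show "(\<lambda>z. z) \<in> hom (T (Suc n)) (T (Suc n))"
      by (rule homI) auto
    fix x r assume x: "x \<in> carrier (P (Suc n))" and r: "r \<in> carrier N"
    have "pure (Suc n) x r = pure (Suc n) ((\<delta> (Suc n) (s (Suc n) x) \<oplus>\<^bsub>P (Suc n)\<^esub> s n (\<delta> n x))
        \<oplus>\<^bsub>P (Suc n)\<^esub> g (Suc n) x \<odot>\<^bsub>P (Suc n)\<^esub> p (Suc n)) r"
      using homotopy[OF x] by simp
    also have "\<dots> = ?h (pure (Suc n) x r)"
      using x r by (simp add: pure_tensor_add_left[OF P N] pure_tensor_smult[OF P N] S_pure D_pure G_pure)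
    finally show "pure (Suc n) x r = ?h (pure (Suc n) x r)" .
  qed
  then show ?thesis by simp
qed

lemma D_group_hom: "group_hom (T (Suc n)) (T n) (D n)"
  using T_group D_hom by (simp add: group_hom_def group_hom_axioms_def)

lemma D_image_subset_kernel:
  "D (Suc n) ` carrier (T (Suc (Suc n))) \<subseteq> kernel (T (Suc n)) (T n) (D n)"
  using D_D hom_in_carrier[OF D_hom] by (auto simp: kernel_def)

text \<open>For a cycle the factor \<open>S n (D n z)\<close> of \<open>T_homotopy\<close> is
  trivial.\<close>

lemma kernel_D_decomposition:
  assumes "z \<in> kernel (T (Suc n)) (T n) (D n)"
  shows "z = D (Suc n) (S (Suc n) z) \<otimes>\<^bsub>T (Suc n)\<^esub> pure (Suc n) (p (Suc n)) (G (Suc n) z)"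
proof -
  interpret TS: group "T (Suc n)" by (rule T_group)
  have z: "z \<in> carrier (T (Suc n))" "D n z = \<one>\<^bsub>T n\<^esub>"
    using assms by (auto simp: kernel_def)
  moreover have "S n \<one>\<^bsub>T n\<^esub> = \<one>\<^bsub>T (Suc n)\<^esub>"
    by (rule hom_one[OF S_hom T_group T_group])
  moreover have "D (Suc n) (S (Suc n) z) \<in> carrier (T (Suc n))"
    using z hom_in_carrier[OF S_hom] hom_in_carrier[OF D_hom] by blast
  ultimately show ?thesis
    using T_homotopy[OF z(1)] by simp
qed

text \<open>In degree m+1 the outgoing multiplier is \<kappa>, which kills N, and the incoming one
  is \<open>t\<close>: every element of N gives a cycle, and boundaries account for tN.\<close>

theorem Tor_odd:
  assumes "even m"
  shows "Tor R P \<delta> N (Suc m) \<cong> Y"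
proof -
  have \<theta>: "\<theta> m = \<kappa>" "\<theta> (Suc m) = t"
    using assms by (simp_all add: \<theta>_def)
  interpret Dm: group_hom "T (Suc m)" "T m" "D m" by (rule D_group_hom)
  let ?Z = "kernel (T (Suc m)) (T m) (D m)"
  have "homology_at (T (Suc (Suc m))) (T (Suc m)) (T m) (D (Suc m)) (D m) \<cong> Y"
  proof (rule homology_at_iso[OF D_group_hom Y, where v = "\<lambda>z. q (G (Suc m) z)"])
    show "(\<lambda>z. q (G (Suc m) z)) \<in> hom (T (Suc m)\<lparr>carrier := ?Z\<rparr>) Y"
    proof (rule homI)
      fix z z' assume "z \<in> carrier (T (Suc m)\<lparr>carrier := ?Z\<rparr>)" "z' \<in> carrier (T (Suc m)\<lparr>carrier := ?Z\<rparr>)"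
      then have "z \<in> carrier (T (Suc m))" "z' \<in> carrier (T (Suc m))"
        by (auto simp: kernel_def)
      then show "q (G (Suc m) (z \<otimes>\<^bsub>T (Suc m)\<lparr>carrier := ?Z\<rparr>\<^esub> z'))
          = q (G (Suc m) z) \<otimes>\<^bsub>Y\<^esub> q (G (Suc m) z')"
        using hom_mult[OF G_hom, of z "Suc m" z'] by (simp add: q_add)
    qed (auto simp: kernel_def)
    show "(\<lambda>z. q (G (Suc m) z)) ` ?Z = carrier Y"
    proof (intro equalityI subsetI)
      fix y assume "y \<in> carrier Y"
      then obtain r where r: "r \<in> carrier N" "y = q r"
        using q_surj by blast
      have "pure (Suc m) (p (Suc m)) r \<in> ?Z"
        using r by (simp add: kernel_def pure_tensor_closed[OF P N] D_pure_p \<theta> kappa_smult pure_zero_right)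
      moreover have "q (G (Suc m) (pure (Suc m) (p (Suc m)) r)) = y"
        using r by (simp add: G_pure q_g_p)
      ultimately show "y \<in> (\<lambda>z. q (G (Suc m) z)) ` ?Z"
        by blast
    qed (auto simp: kernel_def)
    show "D (Suc m) ` carrier (T (Suc (Suc m))) \<subseteq> ?Z"
      by (rule D_image_subset_kernel)
    fix z assume z: "z \<in> ?Z"
    show "q (G (Suc m) z) = \<one>\<^bsub>Y\<^esub> \<longleftrightarrow> z \<in> D (Suc m) ` carrier (T (Suc (Suc m)))"
    proof
      assume "z \<in> D (Suc m) ` carrier (T (Suc (Suc m)))"
      then show "q (G (Suc m) z) = \<one>\<^bsub>Y\<^esub>"
        using q_kernel by (auto simp: G_D \<theta>)
    next
      interpret D: group_hom "T (Suc (Suc m))" "T (Suc m)" "D (Suc m)" by (rule D_group_hom)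
      assume "q (G (Suc m) z) = \<one>\<^bsub>Y\<^esub>"
      then obtain r where r: "r \<in> carrier N" "G (Suc m) z = t \<odot>\<^bsub>N\<^esub> r"
        using q_kernel[of "G (Suc m) z"] z by (auto simp: kernel_def)
      \<comment> \<open>As \<open>G (Suc m) z\<close> is \<open>t\<close> times r, the remaining
        term of the decomposition is the boundary of \<open>?p\<close>.\<close>
      let ?p = "pure (Suc (Suc m)) (p (Suc (Suc m))) r"
      have c: "S (Suc m) z \<in> carrier (T (Suc (Suc m)))" "?p \<in> carrier (T (Suc (Suc m)))"
        using z r hom_in_carrier[OF S_hom] by (auto simp: kernel_def pure_tensor_closed[OF P N])
      have "z = D (Suc m) (S (Suc m) z) \<otimes>\<^bsub>T (Suc m)\<^esub> D (Suc m) ?p"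
        using kernel_D_decomposition[OF z] r by (simp add: D_pure_p \<theta>)
      then have "z = D (Suc m) (S (Suc m) z \<otimes>\<^bsub>T (Suc (Suc m))\<^esub> ?p)"
        using c by simp
      then show "z \<in> D (Suc m) ` carrier (T (Suc (Suc m)))"
        using c by blast
    qed
  qed
  then show ?thesis
    by (simp add: Tor_def)
qed

text \<open>Here the outgoing multiplier is \<open>t\<close>: the \<open>G\<close>-value of a cycle
  is killed by \<open>t\<close>, hence zero, and the decomposition leaves only a boundary.\<close>

theorem Tor_even:
  assumes "odd m"
  shows "trivial_group (Tor R P \<delta> N (Suc m))"
proof -
  have "z \<in> D (Suc m) ` carrier (T (Suc (Suc m)))" if z: "z \<in> kernel (T (Suc m)) (T m) (D m)" for z
  proof -
    interpret D: group_hom "T (Suc (Suc m))" "T (Suc m)" "D (Suc m)" by (rule D_group_hom)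
    have zc: "z \<in> carrier (T (Suc m))" "D m z = \<one>\<^bsub>T m\<^esub>"
      using z by (auto simp: kernel_def)
    have "t \<odot>\<^bsub>N\<^esub> G (Suc m) z = \<zero>\<^bsub>N\<^esub>"
      using G_D[OF zc(1)] zc(2) assms hom_one[OF G_hom T_group N.a_group] by (simp add: \<theta>_def)
    then have "G (Suc m) z = \<zero>\<^bsub>N\<^esub>"
      using t_smult_inj zc(1) by simp
    moreover have c: "S (Suc m) z \<in> carrier (T (Suc (Suc m)))"
      using zc hom_in_carrier[OF S_hom] by blast
    ultimately have "z = D (Suc m) (S (Suc m) z)"
      using kernel_D_decomposition[OF z] by (simp add: pure_zero_right)
    then show ?thesis
      using c by blast
  qed
  then have "D (Suc m) ` carrier (T (Suc (Suc m))) = kernel (T (Suc m)) (T m) (D m)"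
    using D_image_subset_kernel by blast
  then show ?thesis
    using homology_at_trivial[OF D_group_hom] by (simp add: Tor_def)
qed

subsection \<open>Ext\<close>

abbreviation "H n \<equiv> Hom_group R (P n) N"
abbreviation "C n \<equiv> (\<lambda>\<phi>. compose (carrier (P (Suc n))) \<phi> (\<delta> n))"

lemma C_group_hom: "group_hom (H n) (H (Suc n)) (C n)"
  by (rule Hom_group_hom_compose[OF P P N \<delta>])

lemma C_C:
  assumes "\<phi> \<in> carrier (H n)"
  shows "C (Suc n) (C n \<phi>) = \<one>\<^bsub>H (Suc (Suc n))\<^esub>"
proof -
  have "\<phi> \<zero>\<^bsub>P n\<^esub> = \<zero>\<^bsub>N\<^esub>"
    using assms linear_maps_zero[OF P N] by (simp add: Hom_group_simps)
  then show ?thesis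
    by (auto simp: compose_def Hom_group_simps resolution_complex[OF res])
qed

lemma C_image_subset_kernel: "C n ` carrier (H n) \<subseteq> kernel (H (Suc n)) (H (Suc (Suc n))) (C (Suc n))"
  using C_C group_hom.hom_closed[OF C_group_hom] by (auto simp: kernel_def)

lemma kernel_CD:
  assumes "\<phi> \<in> kernel (H n) (H (Suc n)) (C n)"
  shows "\<phi> \<in> linear_maps R (P n) N" "\<phi> \<in> extensional (carrier (P n))"
    and "\<And>x. x \<in> carrier (P (Suc n)) \<Longrightarrow> \<phi> (\<delta> n x) = \<zero>\<^bsub>N\<^esub>"
proof -
  show "\<phi> \<in> linear_maps R (P n) N" "\<phi> \<in> extensional (carrier (P n))"
    using assms by (auto simp: kernel_def Hom_group_simps)
  show "\<phi> (\<delta> n x) = \<zero>\<^bsub>N\<^esub>" if "x \<in> carrier (P (Suc n))" for x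
  proof -
    have "C n \<phi> x = \<one>\<^bsub>H (Suc n)\<^esub> x"
      using assms by (simp add: kernel_def)
    then show ?thesis
      using that by (simp add: compose_def Hom_group_simps)
  qed
qed

lemma kernel_CI:
  assumes "\<phi> \<in> linear_maps R (P n) N"
    and "\<And>x. x \<in> carrier (P (Suc n)) \<Longrightarrow> \<phi> (\<delta> n x) = \<zero>\<^bsub>N\<^esub>"
  shows "(\<lambda>x\<in>carrier (P n). \<phi> x) \<in> kernel (H n) (H (Suc n)) (C n)"
  using Hom_groupI[OF P assms(1)] assms(2)
  by (auto simp: kernel_def compose_def Hom_group_simps)

text \<open>\<open>\<theta> n\<close> times \<open>p n\<close> is the boundary of
  \<open>p (Suc n)\<close>, and a cocycle vanishes on boundaries.\<close>

lemma kernel_C_p: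
  assumes "\<phi> \<in> kernel (H n) (H (Suc n)) (C n)"
  shows "\<theta> n \<odot>\<^bsub>N\<^esub> \<phi> (p n) = \<zero>\<^bsub>N\<^esub>"
  using kernel_CD[OF assms] \<delta>_p[of n] linear_maps_smult[OF kernel_CD(1)[OF assms]]
  by (metis p theta_closed)

text \<open>Dual of \<open>kernel_D_decomposition\<close>: apply \<phi> to the homotopy identity,
  where its values on boundaries vanish.\<close>

lemma kernel_C_decomposition:
  assumes \<phi>: "\<phi> \<in> kernel (H (Suc n)) (H (Suc (Suc n))) (C (Suc n))" and x: "x \<in> carrier (P (Suc n))"
  shows "\<phi> x = \<phi> (s n (\<delta> n x)) \<oplus>\<^bsub>N\<^esub> g (Suc n) x \<odot>\<^bsub>N\<^esub> \<phi> (p (Suc n))"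
proof -
  interpret PS: module R "P (Suc n)" by (rule P)
  note lin = kernel_CD(1)[OF \<phi>]
  have "\<phi> x = \<phi> ((\<delta> (Suc n) (s (Suc n) x) \<oplus>\<^bsub>P (Suc n)\<^esub> s n (\<delta> n x))
        \<oplus>\<^bsub>P (Suc n)\<^esub> g (Suc n) x \<odot>\<^bsub>P (Suc n)\<^esub> p (Suc n))"
    using homotopy[OF x] by simp
  also have "\<dots> = \<phi> (s n (\<delta> n x)) \<oplus>\<^bsub>N\<^esub> g (Suc n) x \<odot>\<^bsub>N\<^esub> \<phi> (p (Suc n))"
    using x by (simp add: linear_maps_add[OF lin] linear_maps_smult[OF lin] linear_maps_closed[OF lin]
        kernel_CD(3)[OF \<phi>])
  finally show ?thesis .
qed

lemma kernel_C_imp_image: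
  assumes \<phi>: "\<phi> \<in> kernel (H (Suc m)) (H (Suc (Suc m))) (C (Suc m))"
    and r: "r \<in> carrier N" "\<phi> (p (Suc m)) = \<theta> m \<odot>\<^bsub>N\<^esub> r"
  shows "\<phi> \<in> C m ` carrier (H m)"
proof (rule image_eqI)
  \<comment> \<open>Composed with \<delta>, the first summand is the homotopy term of the
    decomposition; by \<open>g_\<delta>\<close> the second one becomes the term with
    \<open>\<phi> (p (Suc m))\<close>.\<close>
  let ?\<psi> = "\<lambda>x. \<phi> (s m x) \<oplus>\<^bsub>N\<^esub> g m x \<odot>\<^bsub>N\<^esub> r"
  note lin = kernel_CD(1)[OF \<phi>]
  show "(\<lambda>x\<in>carrier (P m). ?\<psi> x) \<in> carrier (H m)"
    by (intro Hom_groupI[OF P] linear_maps_add_fun[OF N] linear_maps_comp[OF s lin]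
        linear_maps_smult_const[OF N g r(1)])
  show "\<phi> = C m (\<lambda>x\<in>carrier (P m). ?\<psi> x)"
  proof (rule extensionalityI[OF kernel_CD(2)[OF \<phi>]])
    fix x assume x: "x \<in> carrier (P (Suc m))"
    have "g (Suc m) x \<odot>\<^bsub>N\<^esub> (\<theta> m \<odot>\<^bsub>N\<^esub> r) = g m (\<delta> m x) \<odot>\<^bsub>N\<^esub> r"
      using x r(1) by (simp add: g_\<delta>[symmetric] m_comm flip: N.smult_assoc1)
    then show "\<phi> x = C m (\<lambda>x\<in>carrier (P m). ?\<psi> x) x"
      using kernel_C_decomposition[OF \<phi> x] r x by (simp add: compose_def)
  qed (simp add: compose_def)
qed

text \<open>The outgoing multiplier \<open>t\<close> annihilates the value of a cocycle at
  \<open>p (Suc m)\<close>, which is therefore zero; so r = 0 serves in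
  \<open>kernel_C_imp_image\<close>.\<close>

theorem Ext_odd:
  assumes "even m"
  shows "trivial_group (Ext R P \<delta> N (Suc m))"
proof -
  have "\<phi> \<in> C m ` carrier (H m)" if \<phi>: "\<phi> \<in> kernel (H (Suc m)) (H (Suc (Suc m))) (C (Suc m))" for \<phi>
  proof (rule kernel_C_imp_image[OF \<phi>])
    have "\<phi> (p (Suc m)) = \<zero>\<^bsub>N\<^esub>"
      using kernel_C_p[OF \<phi>] assms linear_maps_closed[OF kernel_CD(1)[OF \<phi>] p]
      by (auto intro: t_smult_inj simp: \<theta>_def)
    then show "\<phi> (p (Suc m)) = \<theta> m \<odot>\<^bsub>N\<^esub> \<zero>\<^bsub>N\<^esub>"
      by simp
  qed simp
  then have "C m ` carrier (H m) = kernel (H (Suc m)) (H (Suc (Suc m))) (C (Suc m))"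
    using C_image_subset_kernel by blast
  then show ?thesis
    using homology_at_trivial[OF C_group_hom] by (simp add: Ext_def)
qed

text \<open>Cocycles are classified by their value at \<open>p (Suc m)\<close>: the outgoing
  \<kappa> imposes no condition on it, and coboundaries change it by elements of tN, as the incoming
  multiplier is \<open>t\<close>.\<close>

theorem Ext_even:
  assumes "odd m"
  shows "Ext R P \<delta> N (Suc m) \<cong> Y"
proof -
  have \<theta>: "\<theta> m = t" "\<theta> (Suc m) = \<kappa>"
    using assms by (simp_all add: \<theta>_def)
  let ?Z = "kernel (H (Suc m)) (H (Suc (Suc m))) (C (Suc m))"
  have cl: "\<phi> (p (Suc m)) \<in> carrier N" if "\<phi> \<in> ?Z" for \<phi>
    using linear_maps_closed[OF kernel_CD(1)[OF that] p] .
  have "homology_at (H m) (H (Suc m)) (H (Suc (Suc m))) (C m) (C (Suc m)) \<cong> Y"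
  proof (rule homology_at_iso[OF C_group_hom Y, where v = "\<lambda>\<phi>. q (\<phi> (p (Suc m)))"])
    show "(\<lambda>\<phi>. q (\<phi> (p (Suc m)))) \<in> hom (H (Suc m)\<lparr>carrier := ?Z\<rparr>) Y"
      by (rule homI) (auto simp: cl q_add Hom_group_simps)
    show "(\<lambda>\<phi>. q (\<phi> (p (Suc m)))) ` ?Z = carrier Y"
    proof (intro equalityI subsetI)
      fix y assume "y \<in> carrier Y"
      then obtain r where r: "r \<in> carrier N" "y = q r"
        using q_surj by blast
      \<comment> \<open>A cocycle, since precomposition with \<delta> produces a factor \<kappa>.
        Its value at \<open>p (Suc m)\<close> is r only up to the scalar treated in
        \<open>q_g_p\<close>.\<close>
      let ?\<phi> = "\<lambda>x\<in>carrier (P (Suc m)). g (Suc m) x \<odot>\<^bsub>N\<^esub> r"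
      have "?\<phi> \<in> ?Z"
        using r by (intro kernel_CI linear_maps_smult_const[OF N g])
          (auto simp: g_\<delta>[symmetric] N.smult_assoc1 \<theta> kappa_smult)
      moreover have "q (?\<phi> (p (Suc m))) = y"
        using r by (simp add: q_g_p)
      ultimately show "y \<in> (\<lambda>\<phi>. q (\<phi> (p (Suc m)))) ` ?Z"
        by blast
    qed (use cl in auto)
    show "C m ` carrier (H m) \<subseteq> ?Z"
      by (rule C_image_subset_kernel)
    fix \<phi> assume \<phi>: "\<phi> \<in> ?Z"
    show "q (\<phi> (p (Suc m))) = \<one>\<^bsub>Y\<^esub> \<longleftrightarrow> \<phi> \<in> C m ` carrier (H m)"
    proof
      assume "q (\<phi> (p (Suc m))) = \<one>\<^bsub>Y\<^esub>"
      then show "\<phi> \<in> C m ` carrier (H m)"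
        using q_kernel[OF cl[OF \<phi>]] kernel_C_imp_image[OF \<phi>] \<theta> by auto
    next
      assume "\<phi> \<in> C m ` carrier (H m)"
      then obtain \<psi> where \<psi>: "\<psi> \<in> linear_maps R (P m) N" "\<phi> = C m \<psi>"
        by (auto simp: Hom_group_simps)
      then have "\<phi> (p (Suc m)) = t \<odot>\<^bsub>N\<^esub> \<psi> (p m)"
        by (simp add: compose_def \<delta>_p \<theta> linear_maps_smult)
      then show "q (\<phi> (p (Suc m))) = \<one>\<^bsub>Y\<^esub>"
        using q_kernel[OF cl[OF \<phi>]] linear_maps_closed[OF \<psi>(1) p] by auto
    qed
  qed
  then show ?thesis
    by (simp add: Ext_def)
qed

end

theorem (in periodic_coefficients) Tor_Ext_quotient:
  fixes P :: "nat \<Rightarrow> ('a, 'p) module"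
  assumes P: "projective_resolution R P \<delta> \<epsilon> quotient"
  shows "Tor R P \<delta> N (2 * j + 1) \<cong> Y" "trivial_group (Tor R P \<delta> N (2 * j + 2))"
    "trivial_group (Ext R P \<delta> N (2 * j + 1))" "Ext R P \<delta> N (2 * j + 2) \<cong> Y"
proof -
  have res: "resolution R P \<delta> \<epsilon> quotient"
    using P by (simp add: projective_resolution_def)
  obtain p g s where "\<And>n. p n \<in> carrier (P n)" "\<And>n. \<delta> n (p (Suc n)) = \<theta> n \<odot>\<^bsub>P n\<^esub> p n"
    and "\<And>n. g n \<in> linear_maps R (P n) (regular_module R)"
    and "\<And>n x. x \<in> carrier (P (Suc n)) \<Longrightarrow> \<theta> n \<otimes> g (Suc n) x = g n (\<delta> n x)"
    and "\<And>n. \<exists>a\<in>carrier R. \<exists>b\<in>carrier R. g n (p n) = \<one> \<oplus> (\<kappa> \<otimes> a \<oplus> t \<otimes> b)"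
    and "\<And>n. s n \<in> linear_maps R (P n) (P (Suc n))"
    and "\<And>n x. x \<in> carrier (P (Suc n)) \<Longrightarrow> x = (\<delta> (Suc n) (s (Suc n) x) \<oplus>\<^bsub>P (Suc n)\<^esub> s n (\<delta> n x))
      \<oplus>\<^bsub>P (Suc n)\<^esub> g (Suc n) x \<odot>\<^bsub>P (Suc n)\<^esub> p (Suc n)"
    by (fact comparison_with_periodic_resolution[OF P])
  then interpret periodic_comparison R t \<kappa> N q Y P \<delta> \<epsilon> p g s
    by (intro periodic_comparison.intro periodic_coefficients_axioms
        periodic_comparison_axioms.intro res)
  \<comment> \<open>The computed degrees have the form \<open>Suc m\<close>, hence m = 2j and m = 2j
    + 1.\<close>
  show "Tor R P \<delta> N (2 * j + 1) \<cong> Y" "trivial_group (Tor R P \<delta> N (2 * j + 2))"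
    "trivial_group (Ext R P \<delta> N (2 * j + 1))" "Ext R P \<delta> N (2 * j + 2) \<cong> Y"
    using Tor_odd[of "2 * j"] Tor_even[of "2 * j + 1"] Ext_odd[of "2 * j"] Ext_even[of "2 * j + 1"]
    by simp_all
qed

section \<open>The ring of integer polynomials modulo \<open>t\<^sup>2 - d\<^sup>2 t\<close>\<close>

text \<open>Since h kills I, it maps each coset to a singleton, which \<open>the_elem\<close> reads
  off. The ideal may be smaller than the kernel, as happens for the single evaluations on
  \<open>A_ring d\<close>.\<close>

lemma ring_hom_quotient_lift:
  assumes I: "ideal I R" and S: "ring S" and h: "h \<in> ring_hom R S"
    and hI: "\<And>x. x \<in> I \<Longrightarrow> h x = \<zero>\<^bsub>S\<^esub>"
  shows "(\<lambda>C. the_elem (h ` C)) \<in> ring_hom (R Quot I) S"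
    and "\<And>x. x \<in> carrier R \<Longrightarrow> the_elem (h ` (I +>\<^bsub>R\<^esub> x)) = h x"
proof -
  interpret I: ideal I R by fact
  interpret S: ring S by fact
  have im: "the_elem (h ` (I +>\<^bsub>R\<^esub> x)) = h x" if x: "x \<in> carrier R" for x
  proof -
    have "h y = h x" if "y \<in> I +>\<^bsub>R\<^esub> x" for y
      using that x ring_hom_closed[OF h x] I.Icarr
      by (auto simp: a_r_coset_def' ring_hom_add[OF h] hI)
    then have "h ` (I +>\<^bsub>R\<^esub> x) = {h x}"
      using I.a_rcos_self[OF x] by blast
    then show ?thesis by simp
  qed
  show "(\<lambda>C. the_elem (h ` C)) \<in> ring_hom (R Quot I) S"
  proof (rule ring_hom_memI)
    note pr = I.rcos_ring_hom
    have rep: "\<exists>x\<in>carrier R. C = I +>\<^bsub>R\<^esub> x" if "C \<in> carrier (R Quot I)" for C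
      using that unfolding FactRing_def A_RCOSETS_def' partial_object.simps by blast
    show "the_elem (h ` C) \<in> carrier S" if "C \<in> carrier (R Quot I)" for C
      using rep[OF that] im ring_hom_closed[OF h] by metis
    fix C C' assume C: "C \<in> carrier (R Quot I)" and C': "C' \<in> carrier (R Quot I)"
    obtain x y where xy: "x \<in> carrier R" "C = I +>\<^bsub>R\<^esub> x" "y \<in> carrier R" "C' = I +>\<^bsub>R\<^esub> y"
      using rep[OF C] rep[OF C'] by blast
    have "the_elem (h ` (C \<otimes>\<^bsub>R Quot I\<^esub> C')) = h (x \<otimes>\<^bsub>R\<^esub> y)"
      unfolding xy ring_hom_mult[OF pr xy(1,3), symmetric] using im xy by simp
    then show "the_elem (h ` (C \<otimes>\<^bsub>R Quot I\<^esub> C')) = the_elem (h ` C) \<otimes>\<^bsub>S\<^esub> the_elem (h ` C')"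
      using xy im by (simp add: ring_hom_mult[OF h])
    have "the_elem (h ` (C \<oplus>\<^bsub>R Quot I\<^esub> C')) = h (x \<oplus>\<^bsub>R\<^esub> y)"
      unfolding xy ring_hom_add[OF pr xy(1,3), symmetric] using im xy by simp
    then show "the_elem (h ` (C \<oplus>\<^bsub>R Quot I\<^esub> C')) = the_elem (h ` C) \<oplus>\<^bsub>S\<^esub> the_elem (h ` C')"
      using xy im by (simp add: ring_hom_add[OF h])
  next
    have "the_elem (h ` \<one>\<^bsub>R Quot I\<^esub>) = h \<one>\<^bsub>R\<^esub>"
      unfolding ring_hom_one[OF I.rcos_ring_hom, symmetric] using im by simp
    then show "the_elem (h ` \<one>\<^bsub>R Quot I\<^esub>) = \<one>\<^bsub>S\<^esub>"
      by (simp add: ring_hom_one[OF h])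
  qed
  show "\<And>x. x \<in> carrier R \<Longrightarrow> the_elem (h ` (I +>\<^bsub>R\<^esub> x)) = h x"
    by (rule im)
qed

text \<open>Through \<open>E\<close> the quotient by \<kappa> becomes the integers and
  \<open>t\<close> becomes multiplication by e. So tN corresponds to the multiples of e, and
  \<open>t\<close> is injective because e is nonzero.\<close>

lemma (in periodic_cring) periodic_coefficients_quotient:
  assumes E: "E \<in> ring_hom R \<Z>" and ker: "\<And>x. x \<in> carrier R \<Longrightarrow> E x = 0 \<longleftrightarrow> x \<in> PIdl \<kappa>"
    and surj: "E ` carrier R = UNIV" and t: "E t = e" and e: "e \<noteq> 0"
  shows "\<exists>q. periodic_coefficients R t \<kappa> quotient q (add_monoid (ZFact e))"
proof -
  let ?K = "PIdl \<kappa>"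
  interpret K: ideal ?K R by (rule kappa_ideal)
  interpret Q: cring "R Quot ?K" by (rule K.quotient_is_cring[OF is_cring])
  interpret J: ideal "Idl\<^bsub>\<Z>\<^esub> {e}" \<Z> by (rule int.genideal_ideal) simp
  interpret Z: cring "ZFact e" by (rule ZFact_is_cring)
  have ringZ: "ring \<Z>"
    using int_is_cring by (rule cring.axioms)
  define E' where "E' C = the_elem (E ` C)" for C
  have E': "E' \<in> ring_hom (R Quot ?K) \<Z>" and E'_pr: "\<And>x. x \<in> carrier R \<Longrightarrow> E' (?K +> x) = E x"
    using ring_hom_quotient_lift[OF kappa_ideal ringZ E] ker K.Icarr unfolding E'_def[abs_def] by auto
  have rep: "\<exists>x\<in>carrier R. C = ?K +> x" if "C \<in> carrier (R Quot ?K)" for C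
    using that unfolding FactRing_def A_RCOSETS_def' partial_object.simps by blast
  have pr: "?K +> x \<in> carrier (R Quot ?K)" if "x \<in> carrier R" for x
    using ring_hom_closed[OF K.rcos_ring_hom that] .
  have E'_mult: "E' (C \<otimes>\<^bsub>R Quot ?K\<^esub> C') = E' C * E' C'"
    and E'_add: "E' (C \<oplus>\<^bsub>R Quot ?K\<^esub> C') = E' C + E' C'"
    if "C \<in> carrier (R Quot ?K)" "C' \<in> carrier (R Quot ?K)" for C C'
    using ring_hom_mult[OF E' that] ring_hom_add[OF E' that] by simp_all
  have E'_zero: "C = \<zero>\<^bsub>R Quot ?K\<^esub>" if "C \<in> carrier (R Quot ?K)" "E' C = 0" for C
    using rep[OF that(1)] that(2) E'_pr ker quotient_module_projection_eq_zero[OF kappa_ideal] by metis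
  have E'_inj: "C = C'"
    if "C \<in> carrier (R Quot ?K)" "C' \<in> carrier (R Quot ?K)" "E' C = E' C'" for C C'
  proof -
    have "E' (C \<ominus>\<^bsub>R Quot ?K\<^esub> C') + E' C' = E' C"
      using that Q.minus_closed[OF that(1,2)]
      by (simp add: a_minus_def Q.a_assoc Q.l_neg flip: E'_add)
    then show ?thesis
      using that E'_zero[OF Q.minus_closed[OF that(1,2)]] Q.r_right_minus_eq by simp
  qed
  have E'_surj: "\<exists>C\<in>carrier (R Quot ?K). E' C = k" for k
    using surj pr E'_pr by (metis UNIV_I imageE)
  define q where "q C = Idl\<^bsub>\<Z>\<^esub> {e} +>\<^bsub>\<Z>\<^esub> E' C" for C
  have q_zero: "q C = \<zero>\<^bsub>ZFact e\<^esub> \<longleftrightarrow> e dvd E' C" for C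
  proof -
    have "q C = \<zero>\<^bsub>ZFact e\<^esub> \<longleftrightarrow> E' C \<in> Idl\<^bsub>\<Z>\<^esub> {e}"
      unfolding q_def ZFact_def
      by (rule cring.quotient_module_projection_eq_zero[OF int_is_cring J.is_ideal]) simp
    also have "\<dots> \<longleftrightarrow> e dvd E' C"
      by (auto simp: int_Idl dvd_def mult.commute)
    finally show ?thesis .
  qed
  have Kt: "E' (?K +> t) = e" and Kk: "?K +> \<kappa> = \<zero>\<^bsub>R Quot ?K\<^esub>"
    using E'_pr t quotient_module_projection_eq_zero[OF kappa_ideal] cgenideal_self by auto
  have "periodic_coefficients R t \<kappa> quotient q (add_monoid (ZFact e))"
  proof (intro periodic_coefficients.intro periodic_cring_axioms periodic_coefficients_axioms.intro
      quotient_module_module kappa_ideal Z.a_group)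
    show "q \<in> hom (add_monoid quotient) (add_monoid (ZFact e))"
    proof (rule homI; simp)
      fix C assume "C \<in> carrier (R Quot ?K)"
      show "q C \<in> carrier (ZFact e)"
        unfolding q_def ZFact_def by (rule ring_hom_closed[OF J.rcos_ring_hom]) simp
      fix C' assume "C' \<in> carrier (R Quot ?K)"
      with \<open>C \<in> carrier (R Quot ?K)\<close>
      show "q (C \<oplus>\<^bsub>R Quot ?K\<^esub> C') = q C \<oplus>\<^bsub>ZFact e\<^esub> q C'"
        unfolding q_def ZFact_def using ring_hom_add[OF J.rcos_ring_hom, of "E' C" "E' C'"]
        by (simp add: E'_add)
    qed
    show "q ` carrier quotient = carrier (add_monoid (ZFact e))"
    proof (intro equalityI subsetI)
      fix y assume "y \<in> carrier (add_monoid (ZFact e))"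
      then obtain k where "y = Idl\<^bsub>\<Z>\<^esub> {e} +>\<^bsub>\<Z>\<^esub> k"
        unfolding ZFact_def FactRing_def A_RCOSETS_def' by auto
      then show "y \<in> q ` carrier quotient"
        using E'_surj[of k] by (auto simp: q_def)
    next
      fix y assume "y \<in> q ` carrier quotient"
      then show "y \<in> carrier (add_monoid (ZFact e))"
        unfolding q_def ZFact_def using ring_hom_closed[OF J.rcos_ring_hom] by auto
    qed
    fix C assume "C \<in> carrier quotient"
    then have C: "C \<in> carrier (R Quot ?K)"
      by simp
    show "\<kappa> \<odot>\<^bsub>quotient\<^esub> C = \<zero>\<^bsub>quotient\<^esub>"
      using C by (simp add: Kk)
    show "q C = \<one>\<^bsub>add_monoid (ZFact e)\<^esub> \<longleftrightarrow> C \<in> (\<lambda>r. t \<odot>\<^bsub>quotient\<^esub> r) ` carrier quotient"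
    proof
      assume "q C = \<one>\<^bsub>add_monoid (ZFact e)\<^esub>"
      then obtain k where k: "E' C = e * k"
        using q_zero[of C] by (auto simp: dvd_def)
      obtain C' where C': "C' \<in> carrier (R Quot ?K)" "E' C' = k"
        using E'_surj by blast
      have "C = (?K +> t) \<otimes>\<^bsub>R Quot ?K\<^esub> C'"
        using C C' k by (intro E'_inj) (simp_all add: E'_mult pr Kt)
      then show "C \<in> (\<lambda>r. t \<odot>\<^bsub>quotient\<^esub> r) ` carrier quotient"
        using C' by simp
    next
      assume "C \<in> (\<lambda>r. t \<odot>\<^bsub>quotient\<^esub> r) ` carrier quotient"
      then obtain C' where "C' \<in> carrier (R Quot ?K)" "C = (?K +> t) \<otimes>\<^bsub>R Quot ?K\<^esub> C'"
        by auto
      then have "e dvd E' C"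
        by (simp add: E'_mult pr Kt)
      then show "q C = \<one>\<^bsub>add_monoid (ZFact e)\<^esub>"
        using q_zero by simp
    qed
    assume "t \<odot>\<^bsub>quotient\<^esub> C = \<zero>\<^bsub>quotient\<^esub>"
    then have "E' ((?K +> t) \<otimes>\<^bsub>R Quot ?K\<^esub> C) = 0"
      using ring_hom_zero[OF E' Q.ring_axioms ringZ] by simp
    then have "E' C = 0"
      using C e by (simp add: E'_mult pr Kt)
    then show "C = \<zero>\<^bsub>quotient\<^esub>"
      using E'_zero[OF C] by simp
  qed
  then show ?thesis
    by blast
qed

section \<open>Evaluation and factorization of integer polynomials\<close>

context
begin

interpretation UPZ: UP_cring \<Z> "UP \<Z>"
  using int_is_cring by (simp_all add: UP_cring_def)

definition eval_int :: "int \<Rightarrow> (nat \<Rightarrow> int) \<Rightarrow> int" where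
  "eval_int = eval \<Z> \<Z> id"

lemma eval_int_hom: "eval_int a \<in> ring_hom (UP \<Z>) \<Z>"
  and eval_int_monom: "eval_int a (up_ring.monom (UP \<Z>) r n) = r * a ^ n"
proof -
  interpret UP_pre_univ_prop \<Z> \<Z> id "UP \<Z>"
    using UP_pre_univ_propI[OF int_is_cring int_is_cring id_ring_hom] by simp_all
  show "eval_int a \<in> ring_hom (UP \<Z>) \<Z>"
    unfolding eval_int_def by (rule eval_ring_hom) simp
  show "eval_int a (up_ring.monom (UP \<Z>) r n) = r * a ^ n"
    using eval_monom[of r a n] by (simp add: eval_int_def)
qed

text \<open>The monic polynomial X - a, in the shape in which the remainder theorem produces
  it.\<close>

definition linear_poly :: "int \<Rightarrow> nat \<Rightarrow> int" where
  "linear_poly a = up_ring.monom (UP \<Z>) 1 1 \<ominus>\<^bsub>UP \<Z>\<^esub> up_ring.monom (UP \<Z>) a 0"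

lemma linear_poly_closed [simp]: "linear_poly a \<in> carrier (UP \<Z>)"
  unfolding linear_poly_def by (intro UPZ.P.minus_closed UPZ.monom_closed) simp_all

lemma eval_int_mult:
  "f \<in> carrier (UP \<Z>) \<Longrightarrow> g \<in> carrier (UP \<Z>) \<Longrightarrow> eval_int a (f \<otimes>\<^bsub>UP \<Z>\<^esub> g) = eval_int a f * eval_int a g"
  using ring_hom_mult[OF eval_int_hom, of f g a] by simp

lemma eval_int_minus:
  "f \<in> carrier (UP \<Z>) \<Longrightarrow> g \<in> carrier (UP \<Z>) \<Longrightarrow> eval_int a (f \<ominus>\<^bsub>UP \<Z>\<^esub> g) = eval_int a f - eval_int a g"
proof -
  assume fg: "f \<in> carrier (UP \<Z>)" "g \<in> carrier (UP \<Z>)"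
  have "eval_int a ((f \<ominus>\<^bsub>UP \<Z>\<^esub> g) \<oplus>\<^bsub>UP \<Z>\<^esub> g) = eval_int a (f \<ominus>\<^bsub>UP \<Z>\<^esub> g) + eval_int a g"
    using fg ring_hom_add[OF eval_int_hom, of "f \<ominus>\<^bsub>UP \<Z>\<^esub> g" g a] by simp
  moreover have "(f \<ominus>\<^bsub>UP \<Z>\<^esub> g) \<oplus>\<^bsub>UP \<Z>\<^esub> g = f"
    using fg by (simp add: a_minus_def UPZ.P.a_assoc UPZ.P.l_neg)
  ultimately have "eval_int a f = eval_int a (f \<ominus>\<^bsub>UP \<Z>\<^esub> g) + eval_int a g"
    by simp
  then show ?thesis by simp
qed

lemma eval_int_linear_poly: "eval_int b (linear_poly a) = b - a"
  by (simp add: linear_poly_def eval_int_minus eval_int_monom)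

lemma monom_int_zero: "up_ring.monom (UP \<Z>) 0 n = \<zero>\<^bsub>UP \<Z>\<^esub>"
  using UPZ.monom_zero[of n] by simp

text \<open>The remainder on division by X - a is the constant with the value at a.\<close>

lemma eval_int_eq_zero_imp_factor:
  assumes "f \<in> carrier (UP \<Z>)" "eval_int a f = 0"
  shows "\<exists>q\<in>carrier (UP \<Z>). f = linear_poly a \<otimes>\<^bsub>UP \<Z>\<^esub> q"
proof -
  have "UNIV \<noteq> {0 :: int}"
    by (metis UNIV_I singletonD zero_neq_one)
  from UPZ.remainder_theorem[OF assms(1) UNIV_I this, of a] obtain q where
    q: "q \<in> carrier (UP \<Z>)"
      "f = linear_poly a \<otimes>\<^bsub>UP \<Z>\<^esub> q \<oplus>\<^bsub>UP \<Z>\<^esub> up_ring.monom (UP \<Z>) (eval_int a f) 0"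
    unfolding eval_int_def linear_poly_def by blast
  have "f = linear_poly a \<otimes>\<^bsub>UP \<Z>\<^esub> q"
    by (subst q(2), subst assms(2), subst monom_int_zero)
      (rule UPZ.P.r_zero[OF UPZ.P.m_closed[OF linear_poly_closed q(1)]])
  then show ?thesis
    using q(1) by blast
qed

lemma linear_poly_zero: "linear_poly 0 = up_ring.monom (UP \<Z>) 1 1"
  unfolding linear_poly_def monom_int_zero a_minus_def UPZ.P.minus_zero
  by (rule UPZ.P.r_zero) (rule UPZ.monom_closed[OF UNIV_I])

lemma A_ideal_generator:
  "up_ring.monom (UP \<Z>) 1 2 \<ominus>\<^bsub>UP \<Z>\<^esub> up_ring.monom (UP \<Z>) (d\<^sup>2) 1
    = linear_poly 0 \<otimes>\<^bsub>UP \<Z>\<^esub> linear_poly (d\<^sup>2)"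
  unfolding linear_poly_zero linear_poly_def using UPZ.monom_mult[of 1 1 1 1] UPZ.monom_mult[of 1 "d\<^sup>2" 1 0]
  by (simp add: a_minus_def UPZ.P.r_distr UPZ.P.r_minus numeral_2_eq_2)

lemma A_ideal_ideal: "ideal (A_ideal d) (UP \<Z>)"
  unfolding A_ideal_def A_ideal_generator by (intro UPZ.P.cgenideal_ideal UPZ.P.m_closed) simp_all

text \<open>X and X - d^2 are split off one after the other. The value at d^2 of the first cofactor
  appears multiplied by d^2, which cancels because d is nonzero. This is the injectivity of the
  embedding into two copies of the integers.\<close>

lemma A_ideal_iff:
  assumes f: "f \<in> carrier (UP \<Z>)" and d: "d \<noteq> 0"
  shows "f \<in> A_ideal d \<longleftrightarrow> eval_int 0 f = 0 \<and> eval_int (d\<^sup>2) f = 0"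
proof
  assume "f \<in> A_ideal d"
  then obtain q where "q \<in> carrier (UP \<Z>)" "f = q \<otimes>\<^bsub>UP \<Z>\<^esub> (linear_poly 0 \<otimes>\<^bsub>UP \<Z>\<^esub> linear_poly (d\<^sup>2))"
    unfolding A_ideal_def A_ideal_generator cgenideal_def by blast
  then show "eval_int 0 f = 0 \<and> eval_int (d\<^sup>2) f = 0"
    by (simp add: eval_int_mult eval_int_linear_poly)
next
  assume *: "eval_int 0 f = 0 \<and> eval_int (d\<^sup>2) f = 0"
  obtain g where g: "g \<in> carrier (UP \<Z>)" "f = linear_poly 0 \<otimes>\<^bsub>UP \<Z>\<^esub> g"
    using eval_int_eq_zero_imp_factor[OF f] * by blast
  have "eval_int (d\<^sup>2) g = 0"
    using * d g by (simp add: eval_int_mult eval_int_linear_poly)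
  then obtain h where h: "h \<in> carrier (UP \<Z>)" "g = linear_poly (d\<^sup>2) \<otimes>\<^bsub>UP \<Z>\<^esub> h"
    using eval_int_eq_zero_imp_factor[OF g(1)] by blast
  have "f = h \<otimes>\<^bsub>UP \<Z>\<^esub> (linear_poly 0 \<otimes>\<^bsub>UP \<Z>\<^esub> linear_poly (d\<^sup>2))"
    using g(2) h by (simp add: UPZ.P.m_ac)
  then show "f \<in> A_ideal d"
    unfolding A_ideal_def A_ideal_generator cgenideal_def using h(1) by blast
qed

section \<open>The ring \<open>A_ring d\<close> and its two evaluations\<close>

lemma A_ring_cring: "cring (A_ring d)"
  unfolding A_ring_def by (rule ideal.quotient_is_cring[OF A_ideal_ideal UPZ.P.is_cring])

lemma A_ring_projection_hom: "(+>\<^bsub>UP \<Z>\<^esub>) (A_ideal d) \<in> ring_hom (UP \<Z>) (A_ring d)"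
  unfolding A_ring_def by (rule ideal.rcos_ring_hom[OF A_ideal_ideal])

text \<open>An additive map on the integers is determined by its value at 1. This evaluates the
  integer multiple of one in the definition of \<open>kappa\<close>.\<close>

lemma add_pow_eqI:
  assumes "ring R" and "\<And>k. \<phi> k \<in> carrier R" and "\<And>k l. \<phi> (k + l) = \<phi> k \<oplus>\<^bsub>R\<^esub> \<phi> l"
  shows "add_pow R (k::int) (\<phi> 1) = \<phi> k"
proof -
  interpret R: ring R by fact
  have "\<phi> \<in> hom integer_group (add_monoid R)"
    using assms(2,3) by (intro homI) simp_all
  from hom_int_pow[OF this _ group_integer_group R.a_group, of 1 k] show ?thesis
    by (simp add: add_pow_def)
qed

text \<open>The d^2-fold sum of one is the class of a constant polynomial. With this form \<kappa>
  can be evaluated, and its principal ideal is treated like that of \<open>t\<close>, the class of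
  X.\<close>

lemma kappa_eq: "kappa d = A_ideal d +>\<^bsub>UP \<Z>\<^esub> linear_poly (d\<^sup>2)"
proof -
  let ?pr = "(+>\<^bsub>UP \<Z>\<^esub>) (A_ideal d)"
  interpret A: cring "A_ring d" by (rule A_ring_cring)
  interpret pr: ring_hom_ring "UP \<Z>" "A_ring d" ?pr
    unfolding A_ring_def by (rule ideal.rcos_ring_hom_ring[OF A_ideal_ideal])
  let ?\<phi> = "\<lambda>k. ?pr (up_ring.monom (UP \<Z>) k 0)"
  have mc: "up_ring.monom (UP \<Z>) k n \<in> carrier (UP \<Z>)" for k n
    by (rule UPZ.monom_closed) simp
  have "?\<phi> 1 = \<one>\<^bsub>A_ring d\<^esub>"
    using UPZ.monom_one pr.hom_one by simp
  moreover have "add_pow (A_ring d) (d\<^sup>2) (?\<phi> 1) = ?\<phi> (d\<^sup>2)"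
  proof (rule add_pow_eqI[OF A.ring_axioms])
    show "?\<phi> k \<in> carrier (A_ring d)" for k
      using mc by (rule pr.hom_closed)
    show "?\<phi> (k + l) = ?\<phi> k \<oplus>\<^bsub>A_ring d\<^esub> ?\<phi> l" for k l
      using UPZ.monom_add[of k l 0] pr.hom_add[OF mc mc] by simp
  qed
  ultimately show ?thesis
    unfolding kappa_def t_elem_def
    using mc by (simp add: linear_poly_def a_minus_def)
qed

lemma A_ring_periodic:
  assumes d: "d \<noteq> 0"
  shows "periodic_cring (A_ring d) (t_elem d) (kappa d)"
    and "\<exists>q. periodic_coefficients (A_ring d) (t_elem d) (kappa d) (R_module d) q (add_monoid (ZFact (d\<^sup>2)))"
proof -
  let ?pr = "(+>\<^bsub>UP \<Z>\<^esub>) (A_ideal d)" and ?e = "d\<^sup>2"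
  interpret A: cring "A_ring d" by (rule A_ring_cring)
  have ringZ: "ring \<Z>"
    using int_is_cring by (rule cring.axioms)
  have e: "?e \<noteq> 0"
    using d by simp
  \<comment> \<open>A homomorphism on the quotient only when a is one of the roots 0 and d^2 of the
    relation, whence the side condition on a below.\<close>
  define E where "E a C = the_elem (eval_int a ` C)" for a C
  have prc: "?pr f \<in> carrier (A_ring d)" if "f \<in> carrier (UP \<Z>)" for f
    using ring_hom_closed[OF A_ring_projection_hom that] .
  have pr_mult: "?pr f \<otimes>\<^bsub>A_ring d\<^esub> ?pr g = ?pr (f \<otimes>\<^bsub>UP \<Z>\<^esub> g)"
    if "f \<in> carrier (UP \<Z>)" "g \<in> carrier (UP \<Z>)" for f g
    using ring_hom_mult[OF A_ring_projection_hom that] by simp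
  have rep: "\<exists>f\<in>carrier (UP \<Z>). x = ?pr f" if "x \<in> carrier (A_ring d)" for x
    using that unfolding A_ring_def FactRing_def A_RCOSETS_def' partial_object.simps by blast
  have E: "E a \<in> ring_hom (A_ring d) \<Z>"
    and E_pr: "\<And>f. f \<in> carrier (UP \<Z>) \<Longrightarrow> E a (?pr f) = eval_int a f" if "a = 0 \<or> a = ?e" for a
    using ring_hom_quotient_lift[OF A_ideal_ideal ringZ eval_int_hom, of d a]
      A_ideal_iff[OF _ d] ideal.Icarr[OF A_ideal_ideal] that
    unfolding E_def[abs_def] A_ring_def by auto
  have E_mult: "E a (x \<otimes>\<^bsub>A_ring d\<^esub> y) = E a x * E a y"
    if "a = 0 \<or> a = ?e" "x \<in> carrier (A_ring d)" "y \<in> carrier (A_ring d)" for a x y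
    using ring_hom_mult[OF E[OF that(1)] that(2,3)] by simp
  have E_zero: "x = \<zero>\<^bsub>A_ring d\<^esub> \<longleftrightarrow> E 0 x = 0 \<and> E ?e x = 0" if x: "x \<in> carrier (A_ring d)" for x
  proof -
    obtain f where f: "f \<in> carrier (UP \<Z>)" "x = ?pr f"
      using rep[OF x] by blast
    then show ?thesis
      using UPZ.P.quotient_module_projection_eq_zero[OF A_ideal_ideal f(1)] A_ideal_iff[OF f(1) d] E_pr
      by (simp add: A_ring_def)
  qed
  have tc: "t_elem d = ?pr (linear_poly 0)"
    by (simp add: t_elem_def linear_poly_zero)
  have closed: "t_elem d \<in> carrier (A_ring d)" "kappa d \<in> carrier (A_ring d)"
    unfolding tc kappa_eq by (intro prc linear_poly_closed)+
  have vals: "E 0 (t_elem d) = 0" "E ?e (t_elem d) = ?e" "E 0 (kappa d) = - ?e" "E ?e (kappa d) = 0"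
    unfolding tc kappa_eq by (simp_all add: E_pr eval_int_linear_poly)
  \<comment> \<open>One argument for both ideals: a = 0 gives \<open>t\<close>, a = d^2 gives
    \<kappa>. A representing polynomial that vanishes at a is divisible by X - a before passing to
    the quotient.\<close>
  have PIdl: "E a x = 0 \<longleftrightarrow> x \<in> PIdl\<^bsub>A_ring d\<^esub> (?pr (linear_poly a))"
    if a: "a = 0 \<or> a = ?e" and x: "x \<in> carrier (A_ring d)" for a x
  proof
    assume 0: "E a x = 0"
    obtain f where f: "f \<in> carrier (UP \<Z>)" "x = ?pr f"
      using rep[OF x] by blast
    then obtain g where g: "g \<in> carrier (UP \<Z>)" "f = linear_poly a \<otimes>\<^bsub>UP \<Z>\<^esub> g"
      using eval_int_eq_zero_imp_factor[OF f(1)] E_pr[OF a] 0 by metis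
    have "x = ?pr g \<otimes>\<^bsub>A_ring d\<^esub> ?pr (linear_poly a)"
      using f g by (simp add: pr_mult UPZ.P.m_comm)
    then show "x \<in> PIdl\<^bsub>A_ring d\<^esub> (?pr (linear_poly a))"
      unfolding cgenideal_def using prc[OF g(1)] by blast
  next
    assume "x \<in> PIdl\<^bsub>A_ring d\<^esub> (?pr (linear_poly a))"
    then obtain y where "y \<in> carrier (A_ring d)" "x = y \<otimes>\<^bsub>A_ring d\<^esub> ?pr (linear_poly a)"
      unfolding cgenideal_def by blast
    then show "E a x = 0"
      by (simp add: E_mult[OF a] prc E_pr[OF a] eval_int_linear_poly)
  qed
  show per: "periodic_cring (A_ring d) (t_elem d) (kappa d)"
  proof (intro periodic_cring.intro A_ring_cring periodic_cring_axioms.intro closed)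
    fix x assume x: "x \<in> carrier (A_ring d)"
    \<comment> \<open>Of the two evaluations of \<open>t\<close> times x, the one at 0 always
      vanishes and the one at d^2 is d^2 times that of x. For \<kappa> the roles of the two roots
      are exchanged.\<close>
    show "t_elem d \<otimes>\<^bsub>A_ring d\<^esub> x = \<zero>\<^bsub>A_ring d\<^esub> \<longleftrightarrow> x \<in> PIdl\<^bsub>A_ring d\<^esub> (kappa d)"
      using PIdl[of ?e x] x closed d by (simp add: E_zero E_mult vals kappa_eq[symmetric])
    show "kappa d \<otimes>\<^bsub>A_ring d\<^esub> x = \<zero>\<^bsub>A_ring d\<^esub> \<longleftrightarrow> x \<in> PIdl\<^bsub>A_ring d\<^esub> (t_elem d)"
      using PIdl[of 0 x] x closed d by (simp add: E_zero E_mult vals tc[symmetric])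
  qed
  show "\<exists>q. periodic_coefficients (A_ring d) (t_elem d) (kappa d) (R_module d) q (add_monoid (ZFact ?e))"
    unfolding R_module_def
  proof (rule periodic_cring.periodic_coefficients_quotient[OF per E _ _ vals(2) e])
    show "E ?e x = 0 \<longleftrightarrow> x \<in> PIdl\<^bsub>A_ring d\<^esub> (kappa d)" if "x \<in> carrier (A_ring d)" for x
      using PIdl[of ?e x] that by (simp add: kappa_eq)
    \<comment> \<open>Constant polynomials already realize every integer.\<close>
    have "E ?e (?pr (up_ring.monom (UP \<Z>) k 0)) = k" for k
      using E_pr[of ?e "up_ring.monom (UP \<Z>) k 0"] UPZ.monom_closed[of k 0] by (simp add: eval_int_monom)
    then show "E ?e ` carrier (A_ring d) = UNIV"
      using prc UPZ.monom_closed by (metis UNIV_eq_I image_eqI int_Zcarr)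
  qed simp
qed

end

theorem theorem15p2:
  fixes d :: int
  assumes "d \<ge> 2"
  shows "free_resolution (A_ring d) (\<lambda>_. A_module d) (periodic_differential d) (R_proj d) (R_module d)
    \<and> (\<forall>(P :: nat \<Rightarrow> ((nat \<Rightarrow> int) set, 'p) module) \<delta> \<epsilon>.
         projective_resolution (A_ring d) P \<delta> \<epsilon> (R_module d) \<longrightarrow>
         (\<forall>j. Tor (A_ring d) P \<delta> (R_module d) (2 * j + 1) \<cong> add_monoid (ZFact (d\<^sup>2))
            \<and> trivial_group (Tor (A_ring d) P \<delta> (R_module d) (2 * j + 2))
            \<and> trivial_group (Ext (A_ring d) P \<delta> (R_module d) (2 * j + 1))
            \<and> Ext (A_ring d) P \<delta> (R_module d) (2 * j + 2) \<cong> add_monoid (ZFact (d\<^sup>2))))"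
proof -
  have d: "d \<noteq> 0"
    using assms by simp
  interpret periodic_cring "A_ring d" "t_elem d" "kappa d"
    by (rule A_ring_periodic(1)[OF d])
  obtain q where
    "periodic_coefficients (A_ring d) (t_elem d) (kappa d) (R_module d) q (add_monoid (ZFact (d\<^sup>2)))"
    using A_ring_periodic(2)[OF d] by blast
  then interpret C: periodic_coefficients "A_ring d" "t_elem d" "kappa d" "R_module d" q
    "add_monoid (ZFact (d\<^sup>2))" .
  have "periodic_differential d = (\<lambda>n x. \<theta> n \<otimes>\<^bsub>A_ring d\<^esub> x)"
    by (auto simp: periodic_differential_def \<theta>_def fun_eq_iff)
  moreover have "R_proj d = (+>\<^bsub>A_ring d\<^esub>) (PIdl\<^bsub>A_ring d\<^esub> (kappa d))"
    by (simp add: R_proj_def fun_eq_iff)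
  ultimately have "free_resolution (A_ring d) (\<lambda>_. A_module d) (periodic_differential d) (R_proj d) (R_module d)"
    using periodic_free_resolution by (simp only: A_module_def R_module_def)
  moreover have "Tor (A_ring d) P \<delta> (R_module d) (2 * j + 1) \<cong> add_monoid (ZFact (d\<^sup>2))
      \<and> trivial_group (Tor (A_ring d) P \<delta> (R_module d) (2 * j + 2))
      \<and> trivial_group (Ext (A_ring d) P \<delta> (R_module d) (2 * j + 1))
      \<and> Ext (A_ring d) P \<delta> (R_module d) (2 * j + 2) \<cong> add_monoid (ZFact (d\<^sup>2))"
    if "projective_resolution (A_ring d) P \<delta> \<epsilon> (R_module d)"
    for P :: "nat \<Rightarrow> ((nat \<Rightarrow> int) set, 'p) module" and \<delta> \<epsilon> j
    using C.Tor_Ext_quotient[of P \<delta> \<epsilon> j] that by (simp only: R_module_def simp_thms)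
  ultimately show ?thesis
    by blast
qed

end
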